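(* Let $n\ge 4$ and let $\mathbb{Z}^n\rtimes S_n$ be the semidirect product in which the symmetric group $S_n$ acts on $\mathbb{Z}^n$ by permuting coordinates. Then $\mathbb{Z}^n\rtimes S_n$ is isomorphic to the group with generators $a,b$ and defining relations $$\begin{cases} b^2=e,\\ (baba^{-1})^3=e,\\ (ba^kba^{-k})^2=e, & 2\le k\le n-2,\\ ba^nba^{-n}=e.\end{cases}$$ *)

theory Defs
  imports "HOL-Algebra.Algebra"
begin

section \<open>Free groups\<close>

text \<open>A word is a list of letters; the letter \<open>(x, True)\<close> stands for the generator \<open>x\<close> and
  \<open>(x, False)\<close> for its formal inverse.\<close>

type_synonym 'g word = "('g \<times> bool) list"

inductive cancel_step :: "'g word \<Rightarrow> 'g word \<Rightarrow> bool" where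
  "cancel_step (u @ [(x, s), (x, \<not> s)] @ v) (u @ v)"

definition word_rel :: "('g word \<times> 'g word) set" where
  "word_rel = {(u, v). equivclp cancel_step u v}"

definition free_group :: "'g word set monoid" where
  "free_group = \<lparr>carrier = UNIV // word_rel,
                 monoid.mult = (\<lambda>U V. word_rel `` {u @ v | u v. u \<in> U \<and> v \<in> V}),
                 one = word_rel `` {[]}\<rparr>"

definition free_gen :: "'g \<Rightarrow> 'g word set" where
  "free_gen x = word_rel `` {[(x, True)]}"

section \<open>Presentations\<close>

definition normal_closure :: "('a, 'b) monoid_scheme \<Rightarrow> 'a set \<Rightarrow> 'a set" where
  "normal_closure G R = \<Inter> {N. N \<lhd> G \<and> R \<subseteq> N}"

definition presented_group :: "'g word set set \<Rightarrow> 'g word set set monoid" where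
  "presented_group R = free_group Mod normal_closure free_group R"

section \<open>Semidirect products\<close>

definition semidirect_product ::
    "('n, 'c) monoid_scheme \<Rightarrow> ('h, 'd) monoid_scheme \<Rightarrow> ('h \<Rightarrow> 'n \<Rightarrow> 'n) \<Rightarrow> ('n \<times> 'h) monoid" where
  "semidirect_product N H \<phi> =
     \<lparr>carrier = carrier N \<times> carrier H,
      monoid.mult = (\<lambda>(x, g) (y, h). (x \<otimes>\<^bsub>N\<^esub> \<phi> g y, g \<otimes>\<^bsub>H\<^esub> h)),
      one = (\<one>\<^bsub>N\<^esub>, \<one>\<^bsub>H\<^esub>)\<rparr>"

definition int_lattice :: "nat \<Rightarrow> (nat \<Rightarrow> int) monoid" where
  "int_lattice n = product_group {1..n} (\<lambda>_. integer_group)"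

text \<open>Taking the inverse of \<open>\<sigma>\<close> makes this a left action:
  \<open>\<sigma>\<close> moves the entry in position \<open>i\<close> to position
  \<open>\<sigma> i\<close>.\<close>

definition permute_coords :: "nat \<Rightarrow> (nat \<Rightarrow> nat) \<Rightarrow> (nat \<Rightarrow> int) \<Rightarrow> (nat \<Rightarrow> int)" where
  "permute_coords n \<sigma> = (\<lambda>x \<in> carrier (int_lattice n). \<lambda>i \<in> {1..n}. x (Hilbert_Choice.inv \<sigma> i))"

definition lattice_perm_group :: "nat \<Rightarrow> ((nat \<Rightarrow> int) \<times> (nat \<Rightarrow> nat)) monoid" where
  "lattice_perm_group n = semidirect_product (int_lattice n) (sym_group n) (permute_coords n)"

section \<open>The relators\<close>

datatype gen = Gen_a | Gen_b

definition relators :: "nat \<Rightarrow> gen word set set" where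
  "relators n =
     (let F = free_group; a = free_gen Gen_a; b = free_gen Gen_b in
        {b [^]\<^bsub>F\<^esub> (2::nat),
         (b \<otimes>\<^bsub>F\<^esub> a \<otimes>\<^bsub>F\<^esub> b \<otimes>\<^bsub>F\<^esub> inv\<^bsub>F\<^esub> a) [^]\<^bsub>F\<^esub> (3::nat),
         b \<otimes>\<^bsub>F\<^esub> a [^]\<^bsub>F\<^esub> n \<otimes>\<^bsub>F\<^esub> b \<otimes>\<^bsub>F\<^esub> a [^]\<^bsub>F\<^esub> (- int n)}
        \<union> {(b \<otimes>\<^bsub>F\<^esub> a [^]\<^bsub>F\<^esub> k \<otimes>\<^bsub>F\<^esub> b \<otimes>\<^bsub>F\<^esub> a [^]\<^bsub>F\<^esub> (- int k)) [^]\<^bsub>F\<^esub> (2::nat)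
            | k::nat. 2 \<le> k \<and> k \<le> n - 2})"

end

theory Submission
  imports Defs
begin

text \<open>Put \<open>s\<^sub>i = a\<^sup>i b a\<^bsup>-i\<^esup>\<close>. The relations say that the \<open>s\<^sub>i\<close>, indexed cyclically modulo \<open>n\<close>, satisfy the
  Coxeter relations of affine type \<open>A\<close>, and that \<open>a\<close> rotates them. The elements
  \<open>t\<^sub>0 = a s\<^bsub>n-2\<^esub> \<dots> s\<^sub>0\<close> and \<open>t\<^bsub>i+1\<^esub> = s\<^sub>i t\<^sub>i s\<^sub>i\<close> then commute with each other and are permuted by conjugation with
  \<open>s\<^sub>0, \<dots>, s\<^bsub>n-2\<^esub>\<close>, so every element is \<open>w t\<^sub>0\<^bsup>m(0)\<^esup> \<dots> t\<^bsub>n-1\<^esub>\<^bsup>m(n-1)\<^esup>\<close> with \<open>w\<close> in the usual normal form of the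
  symmetric group. Under the map that sends \<open>a\<close> to a unit vector times the \<open>n\<close>-cycle and \<open>b\<close> to the transposition
  \<open>(1 2)\<close>, these normal forms correspond bijectively to the elements of the semidirect product.\<close>

section \<open>Free groups and presentations\<close>

text \<open>Neither a presentation of the symmetric group nor uniqueness of normal forms in the
  presented group is presupposed. One locale states the relations for an arbitrary group and is
  instantiated by the presented group and by the semidirect product. The words then come from the
  same recursion on both sides, and a homomorphism respecting the generators matches them letter by
  letter. Injectivity asks only that a normal form with trivial image be trivial. Behind the
  generators stands the group of bijections of the integers that commute with translation by
  \<open>n\<close>: \<open>a\<close> is k -> k+1, \<open>b\<close> exchanges neighbours k and k+1
  for k congruent to 1, and the \<open>n\<close>-th power of \<open>a\<close> is a central
  translation, which is the content of the last relator. The critical computation is that the first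
  two translations commute. Only there does the cyclic relation between \<open>s n\<close> and
  \<open>s 0\<close> enter; the other pairs follow by conjugation.\<close>

abbreviation word_class :: "'g word \<Rightarrow> 'g word set" where
  "word_class w \<equiv> word_rel `` {w}"

lemma equiv_word_rel: "equiv UNIV word_rel"
  unfolding word_rel_def
proof (rule equivI)
  show "sym {(u, v). equivclp cancel_step u v}"
    by (auto intro: symI equivclp_sym)
  show "trans {(u, v). equivclp cancel_step u v}"
    by (rule transI) (simp, rule equivclp_trans)
qed (auto simp: refl_on_def)

lemma word_class_eq_iff: "word_class u = word_class v \<longleftrightarrow> (u, v) \<in> word_rel"
  using eq_equiv_class_iff[OF equiv_word_rel] by auto

lemma word_class_cancel_step: "cancel_step u v \<Longrightarrow> word_class u = word_class v"
  unfolding word_class_eq_iff by (simp add: word_rel_def r_into_equivclp)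

text \<open>A quantity unchanged by a single cancellation depends only on the class. This serves
  twice: with \<open>f\<close> the class of the word placed in a context, and with \<open>f\<close>
  the evaluation of words in a group.\<close>

lemma word_rel_invariant:
  assumes "(u, v) \<in> word_rel" and "\<And>u v. cancel_step u v \<Longrightarrow> f u = f v"
  shows "f u = f v"
proof -
  have "equivclp cancel_step u v" using assms(1) by (simp add: word_rel_def)
  then show ?thesis
    by (induction rule: equivclp_induct) (use assms(2) in auto)
qed

lemma word_class_context:
  assumes "(u, v) \<in> word_rel"
  shows "word_class (p @ u @ q) = word_class (p @ v @ q)"
proof (rule word_rel_invariant[OF assms])
  fix u v :: "'a word" assume "cancel_step u v"
  then have "cancel_step (p @ u @ q) (p @ v @ q)"
  proof cases
    case (1 u' x s v')
    then show ?thesis using cancel_step.intros[of "p @ u'" x s "v' @ q"] by simp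
  qed
  then show "word_class (p @ u @ q) = word_class (p @ v @ q)"
    by (simp add: word_class_cancel_step)
qed

lemma word_class_append:
  assumes "(u, u') \<in> word_rel" "(v, v') \<in> word_rel"
  shows "word_class (u @ v) = word_class (u' @ v')"
  using word_class_context[OF assms(1), of "[]" v] word_class_context[OF assms(2), of u' "[]"]
  by simp

lemma word_class_cancel: "word_class (u @ (x, s) # (x, \<not> s) # v) = word_class (u @ v)"
  using cancel_step.intros[of u x s v]
  by (simp add: word_class_cancel_step)

lemma carrier_free_group: "carrier free_group = range word_class"
  by (auto simp: free_group_def quotient_def)

lemma one_free_group: "\<one>\<^bsub>free_group\<^esub> = word_class []"
  by (simp add: free_group_def)

text \<open>The product in \<open>free_group\<close> is the saturation of the set of all
  concatenations. That set is nonempty and lies in one class, so the union of the classes of its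
  members is this class.\<close>

lemma mult_free_group: "word_class u \<otimes>\<^bsub>free_group\<^esub> word_class v = word_class (u @ v)"
proof -
  let ?S = "{u' @ v' | u' v'. u' \<in> word_class u \<and> v' \<in> word_class v}"
  have "word_class x = word_class (u @ v)" if "x \<in> ?S" for x
  proof -
    from that obtain u' v' where "x = u' @ v'" "(u, u') \<in> word_rel" "(v, v') \<in> word_rel"
      by auto
    then show ?thesis using word_class_append by metis
  qed
  moreover have "u @ v \<in> ?S"
    using equiv_class_self[OF equiv_word_rel] by blast
  moreover have "word_rel `` ?S = (\<Union>x\<in>?S. word_class x)"
    by (rule Image_eq_UN)
  ultimately have "word_rel `` ?S = word_class (u @ v)"
    by (metis (no_types, lifting) SUP_eq_const empty_iff)
  then show ?thesis by (simp add: free_group_def)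
qed

lemma word_class_inverse:
  "word_class (rev (map (\<lambda>(x, s). (x, \<not> s)) w) @ w) = word_class []"
proof (induction w)
  case (Cons l w)
  obtain x s where l: "l = (x, s)" by (cases l)
  show ?case
    using Cons word_class_cancel[of "rev (map (\<lambda>(x, s). (x, \<not> s)) w)" x "\<not> s" w]
    by (simp add: l)
qed simp

lemma group_free_group: "group free_group"
proof (rule groupI)
  fix x :: "'a word set" assume "x \<in> carrier free_group"
  then obtain w where "x = word_class w" by (auto simp: carrier_free_group)
  then show "\<exists>y\<in>carrier free_group. y \<otimes>\<^bsub>free_group\<^esub> x
      = \<one>\<^bsub>free_group\<^esub>"
    by (auto simp: carrier_free_group mult_free_group one_free_group
        intro!: word_class_inverse exI[of _ "rev (map (\<lambda>(x, s). (x, \<not> s)) w)"])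
qed (auto simp: carrier_free_group mult_free_group one_free_group)

interpretation free_group: group free_group
  by (rule group_free_group)

lemma free_gen_closed [simp]: "free_gen x \<in> carrier free_group"
  by (simp add: free_gen_def carrier_free_group)

lemma inv_free_gen: "inv\<^bsub>free_group\<^esub> (free_gen x) = word_class [(x, False)]"
proof (rule free_group.inv_equality)
  show "word_class [(x, False)] \<otimes>\<^bsub>free_group\<^esub> free_gen x = \<one>\<^bsub>free_group\<^esub>"
    using word_class_cancel[of "[]" x False "[]"]
    by (simp add: free_gen_def mult_free_group one_free_group)
qed (auto simp: free_gen_def carrier_free_group)

lemma free_group_generated:
  assumes "subgroup H free_group" "\<And>x. free_gen x \<in> H"
  shows "carrier free_group \<subseteq> H"
proof -
  interpret H: subgroup H free_group by fact
  have "word_class w \<in> H" for w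
  proof (induction w)
    case Nil
    show ?case using H.one_closed by (simp add: one_free_group)
  next
    case (Cons l w)
    obtain x s where l: "l = (x, s)" by (cases l)
    have "word_class [l] \<in> H"
      using assms(2)[of x] H.m_inv_closed[OF assms(2)[of x]] 
      by (cases s) (auto simp: l free_gen_def inv_free_gen[unfolded free_gen_def])
    from H.m_closed[OF this Cons] show ?case by (simp add: mult_free_group)
  qed
  then show ?thesis by (auto simp: carrier_free_group)
qed

lemma (in group) free_group_lift:
  assumes f: "\<And>x. f x \<in> carrier G"
  obtains h where "h \<in> hom free_group G" "\<And>x. h (free_gen x) = f x"
proof -
  define ev where "ev = (\<lambda>w. foldr (\<lambda>(x, s) y. (if s then f x else inv (f x)) \<otimes> y) w \<one>)"
  have ev_closed: "ev w \<in> carrier G" for w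
    by (induction w) (auto simp: ev_def f split: if_splits)
  have ev_Cons: "ev ((x, s) # w) = (if s then f x else inv (f x)) \<otimes> ev w" for x s w
    by (simp add: ev_def)
  have ev_append: "ev (u @ v) = ev u \<otimes> ev v" for u v
  proof (induction u)
    case Nil
    show ?case using ev_closed[of v] by (simp add: ev_def)
  next
    case (Cons l u)
    then show ?case using ev_closed f by (cases l) (auto simp: ev_Cons m_assoc)
  qed
  have "ev u = ev v" if "cancel_step u v" for u v
    using that
  proof cases
    case (1 u' x s v')
    have "ev ((x, s) # (x, \<not> s) # v') = ev v'"
      using ev_closed f by (simp add: ev_Cons flip: m_assoc)
    then show ?thesis by (simp add: 1 ev_append)
  qed
  then have ev_rel: "ev u = ev v" if "(u, v) \<in> word_rel" for u v
    using word_rel_invariant that by metis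
  \<comment> \<open>Since \<open>ev\<close> is constant on each class, its image there is a
    singleton and \<open>the_elem\<close> extracts the value on the quotient.\<close>
  define h where "h = (\<lambda>U. the_elem (ev ` U))"
  have h: "h (word_class w) = ev w" for w
  proof -
    have "ev ` word_class w = {ev w}"
      using ev_rel equiv_class_self[OF equiv_word_rel] by fastforce
    then show ?thesis by (simp add: h_def)
  qed
  have "h \<in> hom free_group G"
    by (rule homI) (auto simp: carrier_free_group mult_free_group h ev_closed ev_append)
  moreover have "h (free_gen x) = f x" for x
    unfolding free_gen_def h using f by (simp add: ev_def)
  ultimately show ?thesis using that by blast
qed

section \<open>Normal closures and the universal property of a presentation\<close>

lemma (in group) normal_Inter:
  assumes "\<N> \<noteq> {}" "\<And>N. N \<in> \<N> \<Longrightarrow> N \<lhd> G"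
  shows "\<Inter>\<N> \<lhd> G"
proof -
  have "subgroup (\<Inter>\<N>) G"
    by (rule subgroups_Inter) (use assms normal_imp_subgroup in auto)
  then show ?thesis
    using assms normal_inv_iff by auto
qed

lemma (in group) normal_closure_normal:
  assumes "R \<subseteq> carrier G"
  shows "normal_closure G R \<lhd> G"
proof -
  \<comment> \<open>The intersection needs a nonempty family; the whole group is a member because
    \<open>R\<close> lies in the carrier.\<close>
  have "carrier G \<lhd> G"
    by (simp add: normal_inv_iff subgroup_self)
  then show ?thesis
    unfolding normal_closure_def using assms by (intro normal_Inter) auto
qed

lemma subset_normal_closure: "R \<subseteq> normal_closure G R"
  by (auto simp: normal_closure_def)

abbreviation presented_class :: "'g word set set \<Rightarrow> 'g word set \<Rightarrow> 'g word set set" where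
  "presented_class R x \<equiv> normal_closure free_group R #>\<^bsub>free_group\<^esub> x"

context
  fixes R :: "'g word set set"
  assumes R: "R \<subseteq> carrier free_group"
begin

lemma group_presented_group: "group (presented_group R)"
  unfolding presented_group_def
  by (rule normal.factorgroup_is_group[OF free_group.normal_closure_normal[OF R]])

lemma presented_class_hom: "presented_class R \<in> hom free_group (presented_group R)"
  unfolding presented_group_def
  by (rule normal.r_coset_hom_Mod[OF free_group.normal_closure_normal[OF R]])

lemma presented_class_relator:
  assumes "r \<in> R"
  shows "presented_class R r = \<one>\<^bsub>presented_group R\<^esub>"
proof -
  have "r \<in> normal_closure free_group R" by (rule subsetD[OF subset_normal_closure assms])
  moreover have "subgroup (normal_closure free_group R) free_group"
    by (rule normal_imp_subgroup[OF free_group.normal_closure_normal[OF R]])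
  ultimately show ?thesis
    unfolding presented_group_def one_FactGroup
    by (intro free_group.coset_join2) (auto dest: subgroup.mem_carrier)
qed

text \<open>The kernel of \<open>h\<close> is a normal subgroup containing the relators, hence one
  of the subgroups intersected in \<open>normal_closure\<close>.\<close>

lemma presented_group_lift:
  assumes G: "group G" and h: "h \<in> hom free_group G" and one: "\<And>r. r \<in> R \<Longrightarrow> h r = \<one>\<^bsub>G\<^esub>"
  obtains g where "g \<in> hom (presented_group R) G"
    "\<And>x. x \<in> carrier free_group \<Longrightarrow> g (presented_class R x) = h x"
proof -
  interpret h: group_hom free_group G h
    using G h by (simp add: group_hom_def group_hom_axioms_def group_free_group)
  have "R \<subseteq> kernel free_group G h" using R one by (auto simp: kernel_def)
  then have "normal_closure free_group R \<subseteq> kernel free_group G h"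
    unfolding normal_closure_def using h.normal_kernel by blast
  from h.FactGroup_universal_kernel[OF free_group.normal_closure_normal[OF R] this]
  show ?thesis using that unfolding presented_group_def by blast
qed

text \<open>Pulling \<open>H\<close> back to the free group reduces generation of the quotient to
  generation of the free group by its letters. This supplies the axiom \<open>generated\<close> for
  the presented group.\<close>

lemma presented_group_generated:
  assumes H: "subgroup H (presented_group R)"
    and gen: "\<And>x. presented_class R (free_gen x) \<in> H"
  shows "H = carrier (presented_group R)"
proof -
  interpret h: group_hom free_group "presented_group R" "presented_class R"
    by (simp add: group_hom_def group_hom_axioms_def group_free_group group_presented_group
        presented_class_hom)
  let ?K = "{x \<in> carrier free_group. presented_class R x \<in> H}"
  have "subgroup ?K free_group"
    by (rule free_group.subgroupI)
      (use H in \<open>auto simp: subgroup.one_closed subgroup.m_closed subgroup.m_inv_closed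
        intro!: exI[of _ "\<one>\<^bsub>free_group\<^esub>"]\<close>)
  then have "carrier free_group \<subseteq> ?K"
    by (rule free_group_generated) (use gen in auto)
  then have "carrier (presented_group R) \<subseteq> H"
    unfolding presented_group_def carrier_FactGroup by blast
  then show ?thesis using subgroup.subset[OF H] by blast
qed

end

section \<open>Consequences of the relations\<close>

context group
begin

lemma inv_cancel_left:
  assumes "g \<in> carrier G" "z \<in> carrier G"
  shows "inv g \<otimes> (g \<otimes> z) = z" "g \<otimes> (inv g \<otimes> z) = z"
  using assms by (simp_all flip: m_assoc)

lemma commute_mult:
  assumes "x \<otimes> y = y \<otimes> x" "x \<otimes> z = z \<otimes> x" "x \<in> carrier G" "y \<in> carrier G" "z \<in> carrier G"
  shows "x \<otimes> (y \<otimes> z) = (y \<otimes> z) \<otimes> x"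
proof -
  have "x \<otimes> (y \<otimes> z) = (x \<otimes> y) \<otimes> z" using assms(3-5) by (simp add: m_assoc)
  also have "x \<otimes> y = y \<otimes> x" by fact
  also have "y \<otimes> x \<otimes> z = y \<otimes> (x \<otimes> z)" using assms(3-5) by (simp add: m_assoc)
  also have "x \<otimes> z = z \<otimes> x" by fact
  finally show ?thesis using assms(3-5) by (simp add: m_assoc)
qed

text \<open>The equation \<open>x \<otimes> y = z \<otimes> x\<close> expresses that
  \<open>x\<close> conjugates \<open>y\<close> to \<open>z\<close>; with \<open>z = y\<close> it is
  commutation. In this form both situations pass to inverses and powers by the same lemmas.\<close>

lemma intertwine_inv:
  assumes "x \<otimes> y = z \<otimes> x" "x \<in> carrier G" "y \<in> carrier G" "z \<in> carrier G"
  shows "x \<otimes> inv y = inv z \<otimes> x"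
proof -
  have "x \<otimes> inv y = inv z \<otimes> (z \<otimes> x) \<otimes> inv y"
    using assms(2-4) by (simp add: m_assoc inv_cancel_left)
  also have "\<dots> = inv z \<otimes> (x \<otimes> y) \<otimes> inv y" using assms by simp
  also have "\<dots> = inv z \<otimes> x" using assms(2-4) by (simp add: m_assoc)
  finally show ?thesis .
qed

lemma intertwine_nat_pow:
  fixes k :: nat
  assumes "x \<otimes> y = z \<otimes> x" "x \<in> carrier G" "y \<in> carrier G" "z \<in> carrier G"
  shows "x \<otimes> y [^] k = z [^] k \<otimes> x"
proof (induction k)
  case (Suc k)
  have "x \<otimes> y [^] Suc k = (x \<otimes> y [^] k) \<otimes> y" using assms(2-4) by (simp add: m_assoc)
  also have "\<dots> = z [^] k \<otimes> (x \<otimes> y)" unfolding Suc using assms(2-4) by (simp add: m_assoc)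
  also have "\<dots> = z [^] Suc k \<otimes> x" unfolding assms(1) using assms(2-4) by (simp add: m_assoc)
  finally show ?case .
qed (use assms(2) in simp)

lemma intertwine_int_pow:
  fixes k :: int
  assumes "x \<otimes> y = z \<otimes> x" "x \<in> carrier G" "y \<in> carrier G" "z \<in> carrier G"
  shows "x \<otimes> y [^] k = z [^] k \<otimes> x"
proof (cases "k < 0")
  case True
  have "x \<otimes> inv (y [^] nat (- k)) = inv (z [^] nat (- k)) \<otimes> x"
    by (intro intertwine_inv intertwine_nat_pow nat_pow_closed assms)
  then show ?thesis using True by (simp add: int_pow_def2 del: pow_nat)
next
  case False
  have "x \<otimes> y [^] nat k = z [^] nat k \<otimes> x"
    by (intro intertwine_nat_pow assms)
  then show ?thesis using False by (simp add: int_pow_def2 del: pow_nat)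
qed

lemma involution_cancel:
  assumes "x \<otimes> x = \<one>" "x \<in> carrier G" "z \<in> carrier G"
  shows "x \<otimes> (x \<otimes> z) = z"
proof -
  have "x \<otimes> (x \<otimes> z) = (x \<otimes> x) \<otimes> z" using assms(2,3) by (simp add: m_assoc)
  then show ?thesis using assms by simp
qed

text \<open>Both \<open>x \<otimes> y\<close> and \<open>y \<otimes> x\<close> are left inverses of
  \<open>x \<otimes> y\<close>, the first by hypothesis and the second by cancelling
  involutions.\<close>

lemma involutions_commute:
  assumes "x \<otimes> x = \<one>" "y \<otimes> y = \<one>" "(x \<otimes> y) [^] (2::nat) = \<one>" "x \<in> carrier G" "y \<in> carrier G"
  shows "x \<otimes> y = y \<otimes> x"
proof -
  have "(x \<otimes> y) \<otimes> (x \<otimes> y) = \<one>"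
    using assms by (simp add: numeral_2_eq_2)
  moreover have "(y \<otimes> x) \<otimes> (x \<otimes> y) = \<one>"
    using assms by (simp add: m_assoc involution_cancel)
  ultimately show ?thesis
    using assms by (metis m_closed r_cancel)
qed

text \<open>The cube regroups as (xyx)(yxy), while yxy is itself an involution; cancelling yxy on
  the right gives the claim.\<close>

lemma involutions_braid:
  assumes "x \<otimes> x = \<one>" "y \<otimes> y = \<one>" "(x \<otimes> y) [^] (3::nat) = \<one>" "x \<in> carrier G" "y \<in> carrier G"
  shows "x \<otimes> (y \<otimes> x) = y \<otimes> (x \<otimes> y)"
proof -
  have "(x \<otimes> (y \<otimes> x)) \<otimes> (y \<otimes> (x \<otimes> y)) = \<one>"
    using assms by (simp add: numeral_3_eq_3 m_assoc)
  moreover have "(y \<otimes> (x \<otimes> y)) \<otimes> (y \<otimes> (x \<otimes> y)) = \<one>"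
    using assms by (simp add: m_assoc involution_cancel)
  ultimately show ?thesis
    using assms by (metis m_closed r_cancel)
qed

lemma conj_mult:
  assumes "g \<in> carrier G" "x \<in> carrier G" "y \<in> carrier G"
  shows "(g \<otimes> x \<otimes> inv g) \<otimes> (g \<otimes> y \<otimes> inv g)
      = g \<otimes> (x \<otimes> y) \<otimes> inv g"
proof -
  have "(g \<otimes> x \<otimes> inv g) \<otimes> (g \<otimes> y \<otimes> inv g)
      = g \<otimes> x \<otimes> (inv g \<otimes> g) \<otimes> y \<otimes> inv g"
    using assms by (simp add: m_assoc inv_cancel_left)
  then show ?thesis using assms by (simp add: m_assoc)
qed

end

section \<open>The cyclic Coxeter relations and descending words\<close>

locale extended_affine = group G for G (structure) +
  fixes n :: nat and a b :: 'a
  assumes n: "n \<ge> 4"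
    and a_closed [simp]: "a \<in> carrier G"
    and b_closed [simp]: "b \<in> carrier G"
    and b_sq: "b \<otimes> b = \<one>"
    and braid: "(b \<otimes> a \<otimes> b \<otimes> inv a) [^] (3::nat) = \<one>"
    and far: "\<And>k. 2 \<le> k \<Longrightarrow> k \<le> n - 2 \<Longrightarrow> (b \<otimes> a [^] k \<otimes> b \<otimes> inv (a [^] k)) [^] (2::nat) = \<one>"
    and period: "b \<otimes> a [^] n \<otimes> b \<otimes> inv (a [^] n) = \<one>"
begin

definition s :: "nat \<Rightarrow> 'a" where
  "s i = a [^] i \<otimes> b \<otimes> inv (a [^] i)"

lemma s_closed [simp]: "s i \<in> carrier G"
  by (simp add: s_def)

lemma s_0: "s 0 = b"
  by (simp add: s_def)

lemma conj_s: "a [^] i \<otimes> s j \<otimes> inv (a [^] i) = s (i + j)"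
  by (simp add: s_def m_assoc inv_mult_group flip: nat_pow_mult)

lemma a_s: "a \<otimes> s i = s (Suc i) \<otimes> a"
  using conj_s[of 1 i] by (simp add: inv_solve_right')

lemma s_sq [simp]: "s i \<otimes> s i = \<one>"
  by (simp add: s_def conj_mult b_sq)

lemma s_cancel [simp]: "z \<in> carrier G \<Longrightarrow> s i \<otimes> (s i \<otimes> z) = z"
  by (simp add: involution_cancel)

lemma inv_s [simp]: "inv (s i) = s i"
  by (simp add: inv_equality)

lemma s_period: "s (i + n) = s i"
proof -
  have "b \<otimes> s n = \<one>"
    using period by (simp add: s_def m_assoc)
  then have "s n = b" using s_cancel[of "s n" 0] by (simp add: s_0)
  then show ?thesis using conj_s[of i n] by (simp add: s_def)
qed

text \<open>The relator b a b a^(-1) is \<open>s 0 \<otimes> s 1\<close>, so the braid relation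
  holds for this pair; conjugation by powers of \<open>a\<close> carries it to all
  neighbours.\<close>

lemma s_braid: "s i \<otimes> (s (Suc i) \<otimes> s i) = s (Suc i) \<otimes> (s i \<otimes> s (Suc i))"
proof -
  have "s 0 \<otimes> (s 1 \<otimes> s 0) = s 1 \<otimes> (s 0 \<otimes> s 1)"
  proof (rule involutions_braid)
    show "(s 0 \<otimes> s 1) [^] (3::nat) = \<one>"
      using braid by (simp add: s_def m_assoc)
  qed auto
  then have "a [^] i \<otimes> (s 0 \<otimes> (s 1 \<otimes> s 0)) \<otimes> inv (a [^] i)
      = a [^] i \<otimes> (s 1 \<otimes> (s 0 \<otimes> s 1)) \<otimes> inv (a [^] i)"
    by simp
  then show ?thesis
    by (simp add: conj_s flip: conj_mult)
qed

lemma s_braid_left: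
  assumes "z \<in> carrier G"
  shows "s i \<otimes> (s (Suc i) \<otimes> (s i \<otimes> z))
      = s (Suc i) \<otimes> (s i \<otimes> (s (Suc i) \<otimes> z))"
  using arg_cong[OF s_braid[of i], of "\<lambda>x. x \<otimes> z"] assms by (simp add: m_assoc)

text \<open>The alternatives say that \<open>i\<close> and \<open>j\<close> are not adjacent on a
  cycle of length \<open>n\<close>, with indices left unreduced: they differ by at least 2 and at
  most \<open>n - 2\<close>.\<close>

lemma s_commute:
  assumes "i + 2 \<le> j \<and> j \<le> i + n - 2 \<or> j + 2 \<le> i \<and> i \<le> j + n - 2"
  shows "s i \<otimes> s j = s j \<otimes> s i"
proof -
  have *: "s i \<otimes> s (i + k) = s (i + k) \<otimes> s i" if k: "2 \<le> k" "k \<le> n - 2" for i k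
  proof -
    have "s 0 \<otimes> s k = s k \<otimes> s 0"
    proof (rule involutions_commute)
      show "(s 0 \<otimes> s k) [^] (2::nat) = \<one>"
        using far[OF k] by (simp add: s_def m_assoc)
    qed auto
    then have "a [^] i \<otimes> (s 0 \<otimes> s k) \<otimes> inv (a [^] i) = a [^] i \<otimes> (s k \<otimes> s 0) \<otimes> inv (a [^] i)"
      by simp
    then show ?thesis
      by (simp add: conj_s flip: conj_mult)
  qed
  show ?thesis
    using *[of "j - i" i] *[of "i - j" j] assms by (cases "i \<le> j") auto
qed

text \<open>This is the word s_(i+k-1) ... s_i with \<open>k\<close> letters. It serves both as the
  cycle cancelled in \<open>t 0\<close> and as the coset representative in
  \<open>perm_words\<close>.\<close>

primrec desc :: "nat \<Rightarrow> nat \<Rightarrow> 'a" where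
  "desc i 0 = \<one>"
| "desc i (Suc k) = s (i + k) \<otimes> desc i k"

lemma desc_closed [simp]: "desc i k \<in> carrier G"
  by (induction k) auto

lemma a_desc: "a \<otimes> desc i k = desc (Suc i) k \<otimes> a"
proof (induction k)
  case (Suc k)
  have "a \<otimes> desc i (Suc k) = (a \<otimes> s (i + k)) \<otimes> desc i k" by (simp add: m_assoc)
  also have "\<dots> = s (Suc (i + k)) \<otimes> (a \<otimes> desc i k)" by (simp add: a_s m_assoc)
  finally show ?case by (simp add: Suc m_assoc)
qed simp

lemma desc_Suc_right: "desc i (Suc k) = desc (Suc i) k \<otimes> s i"
  by (induction k) (auto simp: m_assoc)

lemma desc_commute:
  assumes "j + 2 \<le> i \<and> i + k < j + n \<or> i + k < j \<and> j + 2 \<le> i + n"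
  shows "s j \<otimes> desc i k = desc i k \<otimes> s j"
  using assms
proof (induction k)
  case (Suc k)
  have "s j \<otimes> s (i + k) = s (i + k) \<otimes> s j"
    by (rule s_commute) (use Suc.prems in linarith)
  moreover have "s j \<otimes> desc i k = desc i k \<otimes> s j"
    using Suc by auto
  ultimately show ?case by (simp add: commute_mult)
qed simp

text \<open>A letter inside the range slides through the word and changes its index by one, as under
  conjugation by a cycle. The braid relation acts when the newest letter is
  \<open>s (Suc (i + j))\<close>; all later letters are at least two away from
  \<open>s (i + j)\<close>, and \<open>k < n\<close> keeps the distance at most
  \<open>n - 2\<close>.\<close>

lemma desc_exchange:
  assumes "Suc j < k" "k < n"
  shows "desc i k \<otimes> s (Suc (i + j)) = s (i + j) \<otimes> desc i k"
  using assms
proof (induction k)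
  case (Suc k)
  show ?case
  proof (cases "k = Suc j")
    case True
    have "s (Suc (i + j)) \<otimes> desc i j = desc i j \<otimes> s (Suc (i + j))"
      by (rule desc_commute) (use Suc.prems in linarith)
    then show ?thesis
      using s_braid_left[of "desc i j" "i + j"] by (simp add: True m_assoc)
  next
    case False
    have "s (i + j) \<otimes> s (i + k) = s (i + k) \<otimes> s (i + j)"
      by (rule s_commute) (use Suc.prems False in linarith)
    moreover have "desc i k \<otimes> s (Suc (i + j)) = s (i + j) \<otimes> desc i k"
      using Suc False by simp
    ultimately show ?thesis
      by (metis desc.simps(2) desc_closed m_assoc s_closed)
  qed
qed simp

text \<open>In the target, \<open>a\<close> is a unit translation times an \<open>n\<close>-cycle
  and \<open>desc 0 (n - 1)\<close> is the inverse cycle, so \<open>t 0\<close> is a pure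
  translation. Conjugation by \<open>s i\<close> moves its unit vector to the next
  coordinate.\<close>

primrec t :: "nat \<Rightarrow> 'a" where
  "t 0 = a \<otimes> desc 0 (n - 1)"
| "t (Suc i) = s i \<otimes> t i \<otimes> s i"

lemma t_closed [simp]: "t i \<in> carrier G"
  by (induction i) auto

lemma s_t: "s i \<otimes> t i = t (Suc i) \<otimes> s i"
  by (simp add: m_assoc)

lemma s_t_Suc: "s i \<otimes> t (Suc i) = t i \<otimes> s i"
  by (simp add: m_assoc)

text \<open>For \<open>i = 0\<close> the word \<open>desc 0 (n - 1)\<close> lowers the index of
  \<open>s j\<close> by one and \<open>a\<close> raises it again. Each further \<open>t\<close> is a
  conjugate by a letter that commutes with \<open>s j\<close>.\<close>

lemma s_t_greater:
  assumes "i < j" "j \<le> n - 2"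
  shows "s j \<otimes> t i = t i \<otimes> s j"
  using assms
proof (induction i)
  case 0
  then obtain j' where j: "j = Suc j'" by (cases j) auto
  have "t 0 \<otimes> s j = a \<otimes> (desc 0 (n - 1) \<otimes> s (Suc (0 + j')))" by (simp add: j m_assoc)
  also have "\<dots> = a \<otimes> (s (0 + j') \<otimes> desc 0 (n - 1))"
    by (subst desc_exchange) (use 0 j n in auto)
  also have "\<dots> = s j \<otimes> t 0"
    using a_s[of j'] by (simp add: j flip: m_assoc)
  finally show ?case by simp
next
  case (Suc i)
  have "s j \<otimes> s i = s i \<otimes> s j"
    by (rule s_commute) (use Suc.prems in linarith)
  moreover have "s j \<otimes> t i = t i \<otimes> s j" using Suc by simp
  ultimately show ?case by (simp add: commute_mult)
qed

text \<open>The essential case is \<open>i = j + 2\<close>. Conjugation by s_(j+1) s_j takes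
  \<open>t j\<close> to \<open>t (j + 2)\<close> and, by the braid relation, s_(j+1) to s_j; so it
  transports the known commutation of \<open>t j\<close> with s_(j+1).\<close>

lemma s_t_less:
  assumes "Suc j < i" "i < n"
  shows "s j \<otimes> t i = t i \<otimes> s j"
  using assms
proof (induction i)
  case (Suc i)
  show ?case
  proof (cases "i = Suc j")
    case True
    have c: "s (Suc j) \<otimes> t j = t j \<otimes> s (Suc j)"
      by (rule s_t_greater) (use Suc.prems in auto)
    have "s j \<otimes> t (Suc i)
        = s j \<otimes> (s (Suc j) \<otimes> (s j \<otimes> (t j \<otimes> (s j \<otimes> s (Suc j)))))"
      by (simp add: True m_assoc)
    also have "\<dots> = s (Suc j) \<otimes> (s j \<otimes> ((s (Suc j) \<otimes> t j) \<otimes> (s j \<otimes> s (Suc j))))"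
      by (simp add: s_braid_left m_assoc)
    also have "\<dots> = s (Suc j) \<otimes> (s j \<otimes> (t j \<otimes> (s (Suc j) \<otimes> (s j \<otimes> s (Suc j)))))"
      by (simp add: c m_assoc)
    also have "\<dots> = t (Suc i) \<otimes> s j"
      by (simp add: True m_assoc flip: s_braid)
    finally show ?thesis .
  next
    case False
    have "s j \<otimes> s i = s i \<otimes> s j"
      by (rule s_commute) (use Suc.prems False in linarith)
    moreover have "s j \<otimes> t i = t i \<otimes> s j" using Suc False by simp
    ultimately show ?thesis by (simp add: commute_mult)
  qed
qed simp

text \<open>Because \<open>t 1\<close> is the conjugate of \<open>t 0\<close> by \<open>s 0\<close>,
  the claim says that \<open>s 0 \<otimes> t 0\<close> and \<open>t 0 \<otimes> s 0\<close> have
  equal squares. Both squares are brought to the form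
  \<open>a \<otimes> (a \<otimes> (desc 0 m \<otimes> desc 1 m))\<close>.\<close>

lemma t_0_t_1: "t 0 \<otimes> t 1 = t 1 \<otimes> t 0"
proof -
  obtain m where m: "n = Suc (Suc m)" using n that[of "n - 2"] by simp
  have exchange: "desc 0 (Suc m) \<otimes> desc 1 k = desc 0 k \<otimes> desc 0 (Suc m)" if "k \<le> m" for k
    using that
  proof (induction k)
    case (Suc k)
    have "desc 0 (Suc m) \<otimes> desc 1 (Suc k) = (desc 0 (Suc m) \<otimes> s (Suc (0 + k))) \<otimes> desc 1 k"
      by (simp add: m_assoc del: desc.simps(2)) (simp add: m_assoc)
    also have "\<dots> = s k \<otimes> (desc 0 (Suc m) \<otimes> desc 1 k)"
      by (subst desc_exchange) (use Suc.prems m in \<open>auto simp: m_assoc\<close>)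
    also have "\<dots> = desc 0 (Suc k) \<otimes> desc 0 (Suc m)"
      using Suc by (simp add: m_assoc del: desc.simps(2)) (simp add: m_assoc)
    finally show ?case .
  qed simp
  have first: "desc 0 (Suc m) = desc 1 m \<otimes> s 0"
    using desc_Suc_right[of 0 m] by simp
  have a_desc0: "a \<otimes> (desc 0 m \<otimes> z) = desc 1 m \<otimes> (a \<otimes> z)" if "z \<in> carrier G" for z
  proof -
    have "a \<otimes> (desc 0 m \<otimes> z) = (a \<otimes> desc 0 m) \<otimes> z" using that by (simp add: m_assoc)
    also have "a \<otimes> desc 0 m = desc 1 m \<otimes> a" using a_desc[of 0 m] by simp
    finally show ?thesis using that by (simp add: m_assoc)
  qed
  have "n - 1 = Suc m" using m by simp
  then have t0: "t 0 = a \<otimes> desc 0 (Suc m)" by (simp only: t.simps)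
  have t0s: "t 0 \<otimes> s 0 = a \<otimes> desc 1 m"
    unfolding t0 first by (simp add: m_assoc)
  \<comment> \<open>Moving \<open>s m\<close> to the left past two copies of \<open>a\<close> raises
    its index to \<open>m + 2 = n\<close>, and the cyclic relation turns it into
    \<open>s 0\<close>.\<close>
  have aas: "s 0 \<otimes> (a \<otimes> (a \<otimes> z)) = a \<otimes> (a \<otimes> (s m \<otimes> z))" if z: "z \<in> carrier G" for z
  proof -
    have "a \<otimes> (a \<otimes> (s m \<otimes> z))
        = a \<otimes> ((a \<otimes> s m) \<otimes> z)" using z by (simp add: m_assoc)
    also have "a \<otimes> s m = s (Suc m) \<otimes> a" by (rule a_s)
    also have "a \<otimes> (s (Suc m) \<otimes> a \<otimes> z) = (a \<otimes> s (Suc m)) \<otimes> (a \<otimes> z)"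
      using z by (simp add: m_assoc)
    also have "a \<otimes> s (Suc m) = s n \<otimes> a" unfolding m by (rule a_s)
    also have "s n \<otimes> a \<otimes> (a \<otimes> z)
        = s n \<otimes> (a \<otimes> (a \<otimes> z))" using z by (simp add: m_assoc)
    finally show ?thesis using s_period[of 0] by simp
  qed
  have "desc 0 m \<otimes> (desc 1 m \<otimes> s 0) = desc 0 (Suc m) \<otimes> (desc 1 m \<otimes> s 0 \<otimes> s 0)"
    using exchange[of m] first by (simp add: m_assoc del: desc.simps)
  also have "\<dots> = s m \<otimes> (desc 0 m \<otimes> desc 1 m)"
    by (simp add: m_assoc)
  finally have descs: "s m \<otimes> (desc 0 m \<otimes> (desc 1 m \<otimes> s 0)) = desc 0 m \<otimes> desc 1 m"
    by simp
  have "(s 0 \<otimes> t 0) \<otimes> (s 0 \<otimes> t 0) = s 0 \<otimes> (t 0 \<otimes> s 0) \<otimes> t 0"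
    by (simp add: m_assoc del: t.simps)
  also have "\<dots> = s 0 \<otimes> (a \<otimes> desc 1 m) \<otimes> (a \<otimes> (desc 1 m \<otimes> s 0))"
    unfolding t0s unfolding t0 first by simp
  also have "\<dots> = s 0 \<otimes> (a \<otimes> (desc 1 m \<otimes> (a \<otimes> (desc 1 m \<otimes> s 0))))"
    by (simp add: m_assoc)
  also have "\<dots> = s 0 \<otimes> (a \<otimes> (a \<otimes> (desc 0 m \<otimes> (desc 1 m \<otimes> s 0))))"
    by (simp add: a_desc0)
  also have "\<dots> = a \<otimes> (a \<otimes> (desc 0 m \<otimes> desc 1 m))"
    by (simp add: aas descs[unfolded One_nat_def])
  also have "\<dots> = (t 0 \<otimes> s 0) \<otimes> (t 0 \<otimes> s 0)"
    unfolding t0s by (simp add: a_desc0 m_assoc)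
  finally show ?thesis by (simp add: m_assoc del: t.simps(1))
qed

lemma t_commute_Suc: "Suc i < n \<Longrightarrow> t i \<otimes> t (Suc i) = t (Suc i) \<otimes> t i"
proof (induction i)
  case 0
  show ?case using t_0_t_1 by simp
next
  case (Suc i)
  \<comment> \<open>Conjugation by \<open>?g\<close> carries the pair \<open>t i\<close>,
    \<open>t (Suc i)\<close> to the next pair, so commutation propagates from the base case.\<close>
  let ?g = "s i \<otimes> s (Suc i)"
  have c: "s (Suc i) \<otimes> t i = t i \<otimes> s (Suc i)"
    by (rule s_t_greater) (use Suc.prems in auto)
  have c': "s i \<otimes> t (Suc (Suc i)) = t (Suc (Suc i)) \<otimes> s i"
    by (rule s_t_less) (use Suc.prems in auto)
  have g: "?g \<in> carrier G" by simp
  have 1: "?g \<otimes> t i \<otimes> inv ?g = t (Suc i)"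
  proof -
    have "?g \<otimes> t i \<otimes> inv ?g
        = s i \<otimes> (s (Suc i) \<otimes> t i) \<otimes> (s (Suc i) \<otimes> s i)"
      by (simp add: m_assoc inv_mult_group)
    then show ?thesis unfolding c by (simp add: m_assoc)
  qed
  have 2: "?g \<otimes> t (Suc i) \<otimes> inv ?g = t (Suc (Suc i))"
  proof -
    have "?g \<otimes> t (Suc i) \<otimes> inv ?g = (s i \<otimes> t (Suc (Suc i))) \<otimes> s i"
      by (simp add: m_assoc inv_mult_group)
    then show ?thesis unfolding c' by (simp add: m_assoc)
  qed
  have "?g \<otimes> (t i \<otimes> t (Suc i)) \<otimes> inv ?g
      = ?g \<otimes> (t (Suc i) \<otimes> t i) \<otimes> inv ?g"
    using Suc by simp
  then show ?case
    by (metis 1 2 conj_mult g t_closed)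
qed

lemma t_commute_less:
  assumes "i < j" "j < n"
  shows "t i \<otimes> t j = t j \<otimes> t i"
  using assms
proof (induction j)
  case (Suc j)
  show ?case
  proof (cases "i = j")
    case True
    then show ?thesis using t_commute_Suc Suc.prems by simp
  next
    case False
    have "t i \<otimes> s j = s j \<otimes> t i"
      by (rule s_t_greater[symmetric]) (use Suc.prems False in auto)
    moreover have "t i \<otimes> t j = t j \<otimes> t i" using Suc False by simp
    ultimately show ?thesis by (simp add: commute_mult)
  qed
qed simp

lemma t_commute:
  assumes "i < n" "j < n"
  shows "t i \<otimes> t j = t j \<otimes> t i"
  using assms
proof (cases i j rule: linorder_cases)
  case less
  then show ?thesis using assms t_commute_less by blast
next
  case greater
  then show ?thesis using assms t_commute_less[of j i] by simp
qed simp

end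

section \<open>Exponent vectors, permutation words and normal forms\<close>

context extended_affine
begin

lemma s_t_transpose:
  assumes "Suc j < n" "i < n"
  shows "s j \<otimes> t i = t (transpose j (Suc j) i) \<otimes> s j"
proof -
  consider "i = j" | "i = Suc j" | "i < j" | "Suc j < i" by linarith
  then show ?thesis
  proof cases
    case 1
    then show ?thesis using s_t[of j] by simp
  next
    case 2
    then show ?thesis using s_t_Suc[of j] by simp
  next
    case 3
    then show ?thesis using s_t_greater[of i j] assms by (simp add: transpose_apply_other)
  next
    case 4
    then show ?thesis using s_t_less[of j i] assms by (simp add: transpose_apply_other)
  qed
qed

lemma t_pow_s:
  fixes z :: int
  assumes "Suc j < n" "i < n"
  shows "t i [^] z \<otimes> s j = s j \<otimes> t (transpose j (Suc j) i) [^] z"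
proof -
  have "transpose j (Suc j) i < n" using assms by (auto simp: transpose_def)
  from s_t_transpose[OF assms(1) this]
  have "s j \<otimes> t (transpose j (Suc j) i) = t i \<otimes> s j" by simp
  from intertwine_int_pow[OF this, of z] show ?thesis by simp
qed

primrec t_prod :: "(nat \<Rightarrow> int) \<Rightarrow> nat \<Rightarrow> 'a" where
  "t_prod m 0 = \<one>"
| "t_prod m (Suc k) = t_prod m k \<otimes> t k [^] m k"

lemma t_prod_closed [simp]: "t_prod m k \<in> carrier G"
  by (induction k) auto

lemma t_prod_cong: "(\<And>i. i < k \<Longrightarrow> m i = m' i) \<Longrightarrow> t_prod m k = t_prod m' k"
  by (induction k) auto

lemma t_prod_0: "(\<And>i. i < k \<Longrightarrow> m i = 0) \<Longrightarrow> t_prod m k = \<one>"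
  by (induction k) auto

lemma t_prod_pow:
  assumes "j < k" "k \<le> n"
  shows "t_prod m k \<otimes> t j [^] z = t_prod (\<lambda>i. if i = j then m i + z else m i) k"
  using assms
proof (induction k)
  case (Suc k)
  show ?case
  proof (cases "j = k")
    case True
    have "t_prod (\<lambda>i. if i = k then m i + z else m i) k = t_prod m k"
      by (rule t_prod_cong) auto
    then show ?thesis by (simp add: True m_assoc int_pow_mult)
  next
    case False
    have tt: "t k [^] m k \<otimes> t j [^] z = t j [^] z \<otimes> t k [^] m k"
      by (rule intertwine_int_pow, rule intertwine_int_pow[symmetric])
        (use Suc.prems False in \<open>auto intro: t_commute\<close>)
    have "t_prod m (Suc k) \<otimes> t j [^] z = t_prod m k \<otimes> (t k [^] m k \<otimes> t j [^] z)"
      by (simp add: m_assoc)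
    also have "\<dots> = (t_prod m k \<otimes> t j [^] z) \<otimes> t k [^] m k"
      unfolding tt by (simp add: m_assoc)
    also have "t_prod m k \<otimes> t j [^] z = t_prod (\<lambda>i. if i = j then m i + z else m i) k"
      by (rule Suc.IH) (use Suc.prems False in auto)
    finally show ?thesis using False by simp
  qed
qed simp

text \<open>Moving \<open>s j\<close> to the left permutes the exponents. The product on the right
  runs up to \<open>n\<close> because for \<open>k = Suc j\<close> the transposition takes the index
  \<open>j\<close> to \<open>Suc j\<close>, outside the range of the left product.\<close>

lemma t_prod_s:
  assumes "Suc j < n" "k \<le> n"
  shows "\<exists>m'. t_prod m k \<otimes> s j = s j \<otimes> t_prod m' n"
  using assms(2)
proof (induction k)
  case 0
  show ?case
    by (rule exI[of _ "\<lambda>_. 0"]) (simp add: t_prod_0)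
next
  case (Suc k)
  then obtain m' where m': "t_prod m k \<otimes> s j = s j \<otimes> t_prod m' n" by auto
  let ?k = "transpose j (Suc j) k"
  have k: "?k < n" using assms Suc.prems by (auto simp: transpose_def)
  have "t_prod m (Suc k) \<otimes> s j = t_prod m k \<otimes> (t k [^] m k \<otimes> s j)"
    by (simp add: m_assoc)
  also have "t k [^] m k \<otimes> s j = s j \<otimes> t ?k [^] m k"
    by (rule t_pow_s) (use assms Suc.prems in auto)
  also have "t_prod m k \<otimes> (s j \<otimes> t ?k [^] m k) = (t_prod m k \<otimes> s j) \<otimes> t ?k [^] m k"
    by (simp add: m_assoc)
  also have "\<dots> = s j \<otimes> (t_prod m' n \<otimes> t ?k [^] m k)"
    unfolding m' by (simp add: m_assoc)
  also have "t_prod m' n \<otimes> t ?k [^] m k = t_prod (\<lambda>i. if i = ?k then m' i + m k else m' i) n"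
    by (rule t_prod_pow) (use k in auto)
  finally show ?case by blast
qed

text \<open>The words \<open>s\<^sub>k \<dots> s\<^sub>j\<close> are coset representatives of \<open>S\<^bsub>k+1\<^esub>\<close> in \<open>S\<^bsub>k+2\<^esub>\<close>.\<close>

primrec perm_words :: "nat \<Rightarrow> 'a set" where
  "perm_words 0 = {\<one>}"
| "perm_words (Suc k) = {w \<otimes> desc j (Suc k - j) | w j. w \<in> perm_words k \<and> j \<le> Suc k}"

lemma perm_words_closed: "w \<in> perm_words k \<Longrightarrow> w \<in> carrier G"
  by (induction k arbitrary: w) auto

lemma one_perm_words: "\<one> \<in> perm_words k"
proof (induction k)
  case (Suc k)
  then show ?case by (auto intro!: exI[of _ \<one>] exI[of _ "Suc k"])
qed simp

text \<open>The new letter meets the last representative s_k ... s_j. It lengthens it, shortens it,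
  commutes past it, or slides through it with its index lowered by one; in the last two cases the
  induction hypothesis absorbs it into the prefix.\<close>

lemma perm_words_s:
  assumes "w \<in> perm_words k" "i < k" "k < n"
  shows "w \<otimes> s i \<in> perm_words k"
  using assms
proof (induction k arbitrary: w i)
  case (Suc k)
  from Suc.prems obtain v j where w: "w = v \<otimes> desc j (Suc k - j)"
    and v: "v \<in> perm_words k" and j: "j \<le> Suc k" by auto
  have [simp]: "v \<in> carrier G" using v perm_words_closed by blast
  have mem: "u \<otimes> desc j (Suc k - j) \<in> perm_words (Suc k)"
    if "u \<in> perm_words k" "j \<le> Suc k" for u j
    using that by auto
  consider "j = Suc i" | "j = i" | "Suc i < j" | "j < i" by linarith
  then show ?case
  proof cases
    case 1
    have "w \<otimes> s i = v \<otimes> desc i (Suc k - i)"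
      using desc_Suc_right[of i "k - i"] 1 j by (simp add: w m_assoc Suc_diff_le del: desc.simps)
    then show ?thesis using mem[OF v, of i] 1 j by simp
  next
    case 2
    have "w \<otimes> s i = v \<otimes> desc (Suc i) (Suc k - Suc i)"
      using desc_Suc_right[of i "k - i"] 2 Suc.prems
      by (simp add: w m_assoc Suc_diff_le del: desc.simps)
    then show ?thesis using mem[OF v, of "Suc i"] Suc.prems by simp
  next
    case 3
    have "s i \<otimes> desc j (Suc k - j) = desc j (Suc k - j) \<otimes> s i"
      by (rule desc_commute) (use 3 j Suc.prems in linarith)
    then have "w \<otimes> s i = (v \<otimes> s i) \<otimes> desc j (Suc k - j)"
      by (simp add: w m_assoc)
    then show ?thesis using mem[OF Suc.IH[OF v] j] 3 j Suc.prems by simp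
  next
    case 4
    define i' where "i' = i - Suc j"
    have i: "i = Suc (j + i')" using 4 by (simp add: i'_def)
    have "desc j (Suc k - j) \<otimes> s i = s (j + i') \<otimes> desc j (Suc k - j)"
      unfolding i by (rule desc_exchange) (use i Suc.prems in linarith)+
    then have "w \<otimes> s i = (v \<otimes> s (j + i')) \<otimes> desc j (Suc k - j)"
      by (simp add: w m_assoc)
    then show ?thesis using mem[OF Suc.IH[OF v] j, of "j + i'"] i Suc.prems by simp
  qed
qed simp

end

locale generated_extended_affine = extended_affine +
  assumes generated: "\<And>H. subgroup H G \<Longrightarrow> a \<in> H \<Longrightarrow> b \<in> H \<Longrightarrow> H = carrier G"
begin

text \<open>The elements \<open>g\<close> such that \<open>g\<close> and its inverse both preserve
  the set of normal forms under right multiplication form a subgroup. It contains every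
  \<open>s j\<close> with \<open>Suc j < n\<close> and \<open>t 0\<close>, hence also
  \<open>a\<close>, which is \<open>t 0\<close> with its descending word removed.\<close>

lemma normal_form:
  assumes "x \<in> carrier G"
  obtains w m where "w \<in> perm_words (n - 1)" "x = w \<otimes> t_prod m n"
proof -
  define S where "S = {w \<otimes> t_prod m n | w m. w \<in> perm_words (n - 1)}"
  define K where "K = {g \<in> carrier G. \<forall>x\<in>S. x \<otimes> g \<in> S \<and> x \<otimes> inv g \<in> S}"
  have S_closed: "S \<subseteq> carrier G"
    unfolding S_def using perm_words_closed by auto
  have K: "subgroup K G"
  proof (rule subgroupI)
    show "K \<noteq> {}" using S_closed by (auto simp: K_def intro!: exI[of _ \<one>])
  next
    fix g h assume gh: "g \<in> K" "h \<in> K"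
    then have [simp]: "g \<in> carrier G" "h \<in> carrier G" by (auto simp: K_def)
    have "x \<otimes> (g \<otimes> h) \<in> S" "x \<otimes> inv (g \<otimes> h) \<in> S" if "x \<in> S" for x
    proof -
      have [simp]: "x \<in> carrier G" using that S_closed by auto
      have "(x \<otimes> g) \<otimes> h \<in> S" "(x \<otimes> inv h) \<otimes> inv g \<in> S" using gh that by (auto simp: K_def)
      then show "x \<otimes> (g \<otimes> h) \<in> S" "x \<otimes> inv (g \<otimes> h) \<in> S"
        by (simp_all add: m_assoc inv_mult_group)
    qed
    then show "g \<otimes> h \<in> K" by (auto simp: K_def)
  qed (auto simp: K_def)
  have s_K: "s j \<in> K" if "Suc j < n" for j
  proof -
    have "x \<otimes> s j \<in> S" if "x \<in> S" for x
    proof -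
      from that obtain w m where w: "w \<in> perm_words (n - 1)" and x: "x = w \<otimes> t_prod m n"
        by (auto simp: S_def)
      have [simp]: "w \<in> carrier G" using w perm_words_closed by blast
      obtain m' where m': "t_prod m n \<otimes> s j = s j \<otimes> t_prod m' n"
        using t_prod_s[OF \<open>Suc j < n\<close>, of n m] by auto
      have "x \<otimes> s j = w \<otimes> (t_prod m n \<otimes> s j)" by (simp add: x m_assoc)
      also have "\<dots> = (w \<otimes> s j) \<otimes> t_prod m' n" unfolding m' by (simp add: m_assoc)
      finally show ?thesis
        using perm_words_s[OF w, of j] \<open>Suc j < n\<close> by (auto simp: S_def)
    qed
    then show ?thesis by (simp add: K_def)
  qed
  have t_K: "t 0 \<in> K"
  proof -
    have "x \<otimes> t 0 [^] z \<in> S" if "x \<in> S" for x and z :: int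
    proof -
      from that obtain w m where w: "w \<in> perm_words (n - 1)" and x: "x = w \<otimes> t_prod m n"
        by (auto simp: S_def)
      have [simp]: "w \<in> carrier G" using w perm_words_closed by blast
      have "x \<otimes> t 0 [^] z = w \<otimes> (t_prod m n \<otimes> t 0 [^] z)" by (simp add: x m_assoc del: t.simps)
      also have "t_prod m n \<otimes> t 0 [^] z = t_prod (\<lambda>i. if i = 0 then m i + z else m i) n"
        by (rule t_prod_pow) (use n in auto)
      finally show ?thesis using w by (auto simp: S_def)
    qed
    from this[of _ 1] this[of _ "-1"] show ?thesis
      by (simp add: K_def int_pow_neg del: t.simps)
  qed
  have "desc 0 k \<in> K" if "k < n" for k
    using that by (induction k) (auto intro: s_K subgroup.one_closed[OF K] subgroup.m_closed[OF K])
  then have "desc 0 (n - 1) \<in> K" using n by simp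
  then have "t 0 \<otimes> inv (desc 0 (n - 1)) \<in> K"
    using t_K K by (meson subgroup.m_closed subgroup.m_inv_closed)
  then have "a \<in> K" by (simp add: m_assoc)
  moreover have "b \<in> K" using s_K[of 0] n by (simp add: s_0)
  ultimately have "K = carrier G" by (rule generated[OF K])
  moreover have "\<one> \<in> S"
    using one_perm_words t_prod_0[of n "\<lambda>_. 0"]
    by (auto simp: S_def intro!: exI[of _ \<one>] exI[of _ "\<lambda>_. 0"])
  ultimately have "\<one> \<otimes> x \<in> S" using assms unfolding K_def by blast
  then show ?thesis using assms that by (auto simp: S_def)
qed

end

section \<open>Transport of words along a homomorphism\<close>

locale extended_affine_hom =
  dom: extended_affine G n a b + cod: extended_affine H n a' b' + group_hom G H \<phi>
  for G (structure) and H (structure) and n a b a' b' \<phi> +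
  assumes \<phi>_a: "\<phi> a = a'" and \<phi>_b: "\<phi> b = b'"
begin

lemma \<phi>_s: "\<phi> (dom.s i) = cod.s i"
  by (simp add: dom.s_def cod.s_def \<phi>_a \<phi>_b hom_nat_pow)

lemma \<phi>_desc: "\<phi> (dom.desc j k) = cod.desc j k"
  by (induction k) (auto simp: \<phi>_s)

lemma \<phi>_t: "\<phi> (dom.t i) = cod.t i"
  by (induction i) (auto simp: \<phi>_s \<phi>_desc \<phi>_a)

lemma \<phi>_t_prod: "\<phi> (dom.t_prod m k) = cod.t_prod m k"
  by (induction k) (auto simp: \<phi>_t hom_int_pow)

lemma \<phi>_perm_words: "\<phi> ` dom.perm_words k = cod.perm_words k"
proof (induction k)
  case (Suc k)
  have "\<phi> (w \<otimes>\<^bsub>G\<^esub> dom.desc j l) = \<phi> w \<otimes>\<^bsub>H\<^esub> cod.desc j l" if "w \<in> dom.perm_words k" for w j l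
    using dom.perm_words_closed[OF that] by (simp add: \<phi>_desc)
  then have "\<phi> ` dom.perm_words (Suc k)
      = {w \<otimes>\<^bsub>H\<^esub> cod.desc j (Suc k - j) | w j. w \<in> \<phi> ` dom.perm_words k \<and> j \<le> Suc k}"
    by (auto simp: image_iff) metis+
  then show ?case by (simp add: Suc)
qed simp

end

section \<open>The group of translations and permutations\<close>

declare One_nat_def [simp del]

lemma carrier_int_lattice: "carrier (int_lattice n) = {1..n} \<rightarrow>\<^sub>E UNIV"
  by (simp add: int_lattice_def)

lemma carrier_lattice_perm_group:
  "carrier (lattice_perm_group n) = ({1..n} \<rightarrow>\<^sub>E UNIV) \<times> {\<sigma>. \<sigma> permutes {1..n}}"
  by (simp add: lattice_perm_group_def semidirect_product_def carrier_int_lattice sym_group_def)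

text \<open>The hypothesis falls on \<open>y\<close> because \<open>permute_coords\<close> is
  restricted to the lattice and unfolds only there.\<close>

lemma mult_lattice_perm_group:
  assumes "y \<in> {1..n} \<rightarrow>\<^sub>E UNIV"
  shows "(x, \<sigma>) \<otimes>\<^bsub>lattice_perm_group n\<^esub> (y, \<tau>)
    = (\<lambda>i\<in>{1..n}. x i + y (inv' \<sigma> i), \<sigma> \<circ> \<tau>)"
  using assms
  by (auto simp: lattice_perm_group_def semidirect_product_def permute_coords_def
      carrier_int_lattice sym_group_def) (auto simp: int_lattice_def)

lemma one_lattice_perm_group: "\<one>\<^bsub>lattice_perm_group n\<^esub> = (\<lambda>i\<in>{1..n}. 0, id)"
  by (simp add: lattice_perm_group_def semidirect_product_def sym_group_def int_lattice_def)

lemma group_lattice_perm_group: "group (lattice_perm_group n)"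
proof (rule groupI)
  fix p q assume p: "p \<in> carrier (lattice_perm_group n)" and q: "q \<in> carrier (lattice_perm_group n)"
  obtain x \<sigma> y \<tau> where pq: "p = (x, \<sigma>)" "q = (y, \<tau>)" by (metis prod.exhaust)
  show "p \<otimes>\<^bsub>lattice_perm_group n\<^esub> q \<in> carrier (lattice_perm_group n)"
    using p q by (auto simp: pq carrier_lattice_perm_group mult_lattice_perm_group permutes_compose)
  fix r assume r: "r \<in> carrier (lattice_perm_group n)"
  obtain z \<rho> where r': "r = (z, \<rho>)" by (cases r)
  have "inv' (\<sigma> \<circ> \<tau>) = inv' \<tau> \<circ> inv' \<sigma>"
    using p q by (intro o_inv_distrib) (auto simp: pq carrier_lattice_perm_group permutes_bij)
  moreover have "inv' \<sigma> i \<in> {1..n} \<longleftrightarrow> i \<in> {1..n}" for i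
    using p permutes_in_image[OF permutes_inv, of \<sigma> "{1..n}" i]
    by (simp add: pq carrier_lattice_perm_group)
  ultimately show "p \<otimes>\<^bsub>lattice_perm_group n\<^esub> q \<otimes>\<^bsub>lattice_perm_group n\<^esub> r
      = p \<otimes>\<^bsub>lattice_perm_group n\<^esub> (q \<otimes>\<^bsub>lattice_perm_group n\<^esub> r)"
    using p q r
    by (auto simp: pq r' carrier_lattice_perm_group mult_lattice_perm_group o_assoc intro!: restrict_ext)
next
  fix p assume p: "p \<in> carrier (lattice_perm_group n)"
  obtain x \<sigma> where p': "p = (x, \<sigma>)" by (cases p)
  show "\<one>\<^bsub>lattice_perm_group n\<^esub> \<otimes>\<^bsub>lattice_perm_group n\<^esub> p = p"
    using p by (auto simp: p' carrier_lattice_perm_group one_lattice_perm_group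
        mult_lattice_perm_group PiE_def extensional_def)
  have \<sigma>: "\<sigma> permutes {1..n}" using p by (simp add: p' carrier_lattice_perm_group)
  have "inv' (inv' \<sigma>) = \<sigma>" "inv' \<sigma> \<circ> \<sigma> = id"
    using \<sigma> by (auto simp: permutes_inv_inv permutes_inv_o)
  then have "(\<lambda>i\<in>{1..n}. - x (\<sigma> i), inv' \<sigma>) \<otimes>\<^bsub>lattice_perm_group n\<^esub> p = \<one>\<^bsub>lattice_perm_group n\<^esub>"
    using p by (auto simp: p' carrier_lattice_perm_group one_lattice_perm_group
        mult_lattice_perm_group intro!: restrict_ext)
  then show "\<exists>q\<in>carrier (lattice_perm_group n). q \<otimes>\<^bsub>lattice_perm_group n\<^esub> p
      = \<one>\<^bsub>lattice_perm_group n\<^esub>"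
    by (rule bexI) (auto simp: carrier_lattice_perm_group permutes_inv[OF \<sigma>])
qed (auto simp: carrier_lattice_perm_group one_lattice_perm_group permutes_id)

section \<open>The generators of the semidirect product and their relations\<close>

lemma (in monoid) nat_pow_2: "x \<in> carrier G \<Longrightarrow> x [^] (2::nat) = x \<otimes> x"
  by (simp add: numeral_2_eq_2)

lemma (in monoid) nat_pow_3: "x \<in> carrier G \<Longrightarrow> x [^] (3::nat) = x \<otimes> x \<otimes> x"
  by (simp add: numeral_3_eq_3)

text \<open>Two transpositions sharing one point compose to a 3-cycle.\<close>

lemma transpose_braid_id:
  assumes "i \<noteq> j" "j \<noteq> k" "i \<noteq> k"
  shows "transpose i j \<circ> transpose j k \<circ> (transpose i j \<circ> transpose j k) \<circ> (transpose i j \<circ> transpose j k) = id"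
proof
  fix x
  show "(transpose i j \<circ> transpose j k \<circ> (transpose i j \<circ> transpose j k) \<circ> (transpose i j \<circ> transpose j k)) x = id x"
    using assms assms[symmetric]
    by (cases "x = i"; cases "x = j"; cases "x = k"; simp add: transpose_def)
qed

lemma transpose_far_id:
  assumes "i \<noteq> k" "i \<noteq> l" "j \<noteq> k" "j \<noteq> l"
  shows "transpose i j \<circ> transpose k l \<circ> (transpose i j \<circ> transpose k l) = id"
proof
  fix x
  show "(transpose i j \<circ> transpose k l \<circ> (transpose i j \<circ> transpose k l)) x = id x"
    using assms assms[symmetric]
    by (cases "x = i"; cases "x = j"; cases "x = k"; cases "x = l"; simp add: transpose_def)
qed

definition perm_elem :: "nat \<Rightarrow> (nat \<Rightarrow> nat) \<Rightarrow> (nat \<Rightarrow> int) \<times> (nat \<Rightarrow> nat)" where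
  "perm_elem n \<sigma> = (\<lambda>i\<in>{1..n}. 0, \<sigma>)"

definition cycle_perm :: "nat \<Rightarrow> nat \<Rightarrow> nat" where
  "cycle_perm n i = (if i = n then 1 else if 1 \<le> i \<and> i < n then Suc i else i)"

definition unit_vec :: "nat \<Rightarrow> nat \<Rightarrow> nat \<Rightarrow> int" where
  "unit_vec n j = (\<lambda>i\<in>{1..n}. if i = j then 1 else 0)"

text \<open>For the shift k -> k+1, only the step out of position \<open>n\<close> leaves the block
  1, ..., n. It lands at position 1 of the next block, which the unit vector at 1 records.\<close>

definition affine_shift :: "nat \<Rightarrow> (nat \<Rightarrow> int) \<times> (nat \<Rightarrow> nat)" where
  "affine_shift n = (unit_vec n 1, cycle_perm n)"

context
  fixes n :: nat
  assumes n: "n \<ge> 4"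
begin

interpretation L: group "lattice_perm_group n"
  by (rule group_lattice_perm_group)

lemma inj_cycle_perm: "inj (cycle_perm n)"
  using n by (auto simp: inj_def cycle_perm_def split: if_splits)

lemma cycle_perm_permutes: "cycle_perm n permutes {1..n}"
proof (rule bij_imp_permutes)
  have "cycle_perm n ` {1..n} \<subseteq> {1..n}" using n by (auto simp: cycle_perm_def)
  then show "bij_betw (cycle_perm n) {1..n} {1..n}"
    using inj_cycle_perm by (metis bij_betw_def endo_inj_surj finite_atLeastAtMost inj_on_subset subset_UNIV)
qed (use n in \<open>auto simp: cycle_perm_def\<close>)

lemma inv_cycle_perm:
  assumes "i \<in> {1..n}"
  shows "inv' (cycle_perm n) i = (if i = 1 then n else i - 1)"
  by (rule inv_f_eq[OF inj_cycle_perm]) (use assms n in \<open>auto simp: cycle_perm_def\<close>)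

lemma perm_elem_closed [simp]:
  "\<sigma> permutes {1..n} \<Longrightarrow> perm_elem n \<sigma> \<in> carrier (lattice_perm_group n)"
  by (simp add: perm_elem_def carrier_lattice_perm_group)

lemma affine_shift_closed [simp]: "affine_shift n \<in> carrier (lattice_perm_group n)"
  using cycle_perm_permutes
  by (simp add: affine_shift_def unit_vec_def carrier_lattice_perm_group)

lemma perm_elem_mult_pair:
  assumes "x \<in> {1..n} \<rightarrow>\<^sub>E UNIV"
  shows "perm_elem n \<sigma> \<otimes>\<^bsub>lattice_perm_group n\<^esub> (x, \<tau>)
      = (\<lambda>i\<in>{1..n}. x (inv' \<sigma> i), \<sigma> \<circ> \<tau>)"
  using assms by (auto simp: perm_elem_def mult_lattice_perm_group intro!: restrict_ext)

lemma mult_perm_elem: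
  assumes "x \<in> {1..n} \<rightarrow>\<^sub>E UNIV" "\<sigma> permutes {1..n}"
  shows "(x, \<sigma>) \<otimes>\<^bsub>lattice_perm_group n\<^esub> perm_elem n \<tau> = (x, \<sigma> \<circ> \<tau>)"
proof -
  have "(\<lambda>j\<in>{1..n}. 0) (inv' \<sigma> i) = (0 :: int)" if "i \<in> {1..n}" for i
    using that permutes_in_image[OF permutes_inv[OF assms(2)]] by simp
  then have "(\<lambda>i\<in>{1..n}. x i + (\<lambda>j\<in>{1..n}. 0) (inv' \<sigma> i)) = x"
    using assms(1) by (auto simp: PiE_def extensional_def fun_eq_iff)
  then show ?thesis
    unfolding perm_elem_def by (subst mult_lattice_perm_group) auto
qed

lemma perm_elem_mult:
  assumes "\<sigma> permutes {1..n}"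
  shows "perm_elem n \<sigma> \<otimes>\<^bsub>lattice_perm_group n\<^esub> perm_elem n \<tau>
      = perm_elem n (\<sigma> \<circ> \<tau>)"
  using mult_perm_elem[of "\<lambda>i\<in>{1..n}. 0" \<sigma> \<tau>] assms by (simp add: perm_elem_def)

lemma one_perm_elem: "\<one>\<^bsub>lattice_perm_group n\<^esub> = perm_elem n id"
  by (simp add: perm_elem_def one_lattice_perm_group)

lemma transpose_permutes: "i \<in> {1..n} \<Longrightarrow> j \<in> {1..n} \<Longrightarrow> transpose i j permutes {1..n}"
  by (rule permutes_swap_id)

text \<open>By \<open>1 \<le> i\<close> the transposition on the right-hand side avoids coordinate 1
  and fixes the translation part. What remains is the conjugation of a transposition by the
  \<open>n\<close>-cycle.\<close>

lemma affine_shift_perm_elem: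
  assumes "Suc i < n" "1 \<le> i"
  shows "affine_shift n \<otimes>\<^bsub>lattice_perm_group n\<^esub> perm_elem n (transpose i (Suc i))
    = perm_elem n (transpose (Suc i) (Suc (Suc i))) \<otimes>\<^bsub>lattice_perm_group n\<^esub> affine_shift n"
proof -
  have "cycle_perm n \<circ> transpose i (Suc i) = transpose (Suc i) (Suc (Suc i)) \<circ> cycle_perm n"
    using assms by (auto simp: fun_eq_iff cycle_perm_def transpose_def)
  then show ?thesis
    using assms cycle_perm_permutes
    by (auto simp: affine_shift_def mult_perm_elem perm_elem_mult_pair unit_vec_def transpose_def
        intro!: ext)
qed

text \<open>The iteration ends at \<open>i = n - 2\<close>: one step further the cycle wraps around
  and the conjugated transposition acquires a translation part.\<close>

lemma affine_shift_pow_perm_elem: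
  assumes "i + 2 \<le> n"
  shows "affine_shift n [^]\<^bsub>lattice_perm_group n\<^esub> i \<otimes>\<^bsub>lattice_perm_group n\<^esub> perm_elem n (transpose 1 2)
    = perm_elem n (transpose (Suc i) (Suc (Suc i)))
      \<otimes>\<^bsub>lattice_perm_group n\<^esub> affine_shift n [^]\<^bsub>lattice_perm_group n\<^esub> i"
  using assms
proof (induction i)
  case 0
  then show ?case using n by (simp add: transpose_permutes flip: numeral_2_eq_2 One_nat_def)
next
  case (Suc i)
  let ?A = "affine_shift n" and ?p = "\<lambda>i. perm_elem n (transpose (Suc i) (Suc (Suc i)))"
  note [simp] = transpose_permutes
  have "?A [^]\<^bsub>lattice_perm_group n\<^esub> Suc i \<otimes>\<^bsub>lattice_perm_group n\<^esub> perm_elem n (transpose 1 2)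
      = ?A \<otimes>\<^bsub>lattice_perm_group n\<^esub> (?A [^]\<^bsub>lattice_perm_group n\<^esub> i \<otimes>\<^bsub>lattice_perm_group n\<^esub> perm_elem n (transpose 1 2))"
    using n by (simp only: L.nat_pow_Suc2 affine_shift_closed) (simp add: L.m_assoc)
  also have "\<dots> = (?A \<otimes>\<^bsub>lattice_perm_group n\<^esub> ?p i) \<otimes>\<^bsub>lattice_perm_group n\<^esub> ?A [^]\<^bsub>lattice_perm_group n\<^esub> i"
    using Suc by (simp add: L.m_assoc)
  also have "?A \<otimes>\<^bsub>lattice_perm_group n\<^esub> ?p i
      = ?p (Suc i) \<otimes>\<^bsub>lattice_perm_group n\<^esub> ?A"
    by (rule affine_shift_perm_elem) (use Suc.prems in auto)
  also have "?p (Suc i) \<otimes>\<^bsub>lattice_perm_group n\<^esub> ?A \<otimes>\<^bsub>lattice_perm_group n\<^esub> ?A [^]\<^bsub>lattice_perm_group n\<^esub> i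
      = ?p (Suc i) \<otimes>\<^bsub>lattice_perm_group n\<^esub> ?A [^]\<^bsub>lattice_perm_group n\<^esub> Suc i"
    using Suc.prems by (simp only: L.nat_pow_Suc2 affine_shift_closed) (simp add: L.m_assoc)
  finally show ?case .
qed

text \<open>A single shift would leave a transposition with a translation part. The double shift has
  translation part supported equally on coordinates 1 and 2, hence invariant under their
  transposition.\<close>

lemma affine_shift_twice:
  "affine_shift n \<otimes>\<^bsub>lattice_perm_group n\<^esub> (affine_shift n \<otimes>\<^bsub>lattice_perm_group n\<^esub> perm_elem n (transpose (n - 1) n))
    = perm_elem n (transpose 1 2) \<otimes>\<^bsub>lattice_perm_group n\<^esub> (affine_shift n \<otimes>\<^bsub>lattice_perm_group n\<^esub> affine_shift n)"
proof -
  have \<sigma>: "cycle_perm n \<circ> (cycle_perm n \<circ> transpose (n - 1) n)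
      = transpose 1 2 \<circ> (cycle_perm n \<circ> cycle_perm n)"
  proof
    fix i
    have c: "cycle_perm n n = 1" "\<And>i. 1 \<le> i \<Longrightarrow> i < n \<Longrightarrow> cycle_perm n i = Suc i"
      "\<And>i. i = 0 \<or> n < i \<Longrightarrow> cycle_perm n i = i"
      using n by (auto simp: cycle_perm_def)
    consider "i = n - 1" | "i = n" | "1 \<le> i" "i < n - 1" | "i = 0 \<or> n < i" by linarith
    then show "(cycle_perm n \<circ> (cycle_perm n \<circ> transpose (n - 1) n)) i
        = (transpose 1 2 \<circ> (cycle_perm n \<circ> cycle_perm n)) i"
    proof cases
      case 1
      then show ?thesis using n c(1) c(2)[of "n - 1"] c(2)[of 1] by simp
    next
      case 2
      then show ?thesis using n c(1) c(2)[of "n - 1"] c(2)[of 1] by simp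
    next
      case 3
      then have "i \<noteq> n" "i \<noteq> n - 1" "Suc i < n" by auto
      then show ?thesis using 3 n c(2)[of i] c(2)[of "Suc i"] by (simp add: transpose_def)
    next
      case 4
      then show ?thesis using n c(3)[of i] by (auto simp: transpose_def)
    qed
  qed
  have u: "unit_vec n 1 \<in> {1..n} \<rightarrow>\<^sub>E UNIV" by (simp add: unit_vec_def)
  have "affine_shift n \<otimes>\<^bsub>lattice_perm_group n\<^esub> (unit_vec n 1, \<tau>)
      = (\<lambda>i\<in>{1..n}. if i = 1 \<or> i = 2 then 1 else 0, cycle_perm n \<circ> \<tau>)" for \<tau>
    unfolding affine_shift_def mult_lattice_perm_group[OF u]
    using n by (auto simp: inv_cycle_perm unit_vec_def intro!: restrict_ext)
  then show ?thesis
    using n \<sigma> cycle_perm_permutes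
    by (auto simp: affine_shift_def mult_perm_elem u perm_elem_mult_pair transpose_def intro!: restrict_ext)
qed

lemma extended_affine_lattice_perm_group:
  "extended_affine (lattice_perm_group n) n (affine_shift n) (perm_elem n (transpose 1 2))"
proof -
  let ?L = "lattice_perm_group n" and ?A = "affine_shift n" and ?B = "perm_elem n (transpose 1 2)"
  note [simp] = transpose_permutes
  have B: "?B \<in> carrier ?L" using n by simp
  have conj: "?B \<otimes>\<^bsub>?L\<^esub> ?A [^]\<^bsub>?L\<^esub> k \<otimes>\<^bsub>?L\<^esub> ?B \<otimes>\<^bsub>?L\<^esub> inv\<^bsub>?L\<^esub> (?A [^]\<^bsub>?L\<^esub> k)
      = perm_elem n (transpose 1 2 \<circ> transpose (Suc k) (Suc (Suc k)))" if k: "k + 2 \<le> n" for k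
  proof -
    have "?B \<otimes>\<^bsub>?L\<^esub> ?A [^]\<^bsub>?L\<^esub> k \<otimes>\<^bsub>?L\<^esub> ?B \<otimes>\<^bsub>?L\<^esub> inv\<^bsub>?L\<^esub> (?A [^]\<^bsub>?L\<^esub> k)
        = ?B \<otimes>\<^bsub>?L\<^esub> (?A [^]\<^bsub>?L\<^esub> k \<otimes>\<^bsub>?L\<^esub> ?B) \<otimes>\<^bsub>?L\<^esub> inv\<^bsub>?L\<^esub> (?A [^]\<^bsub>?L\<^esub> k)"
      using B by (simp add: L.m_assoc)
    also have "\<dots> = ?B \<otimes>\<^bsub>?L\<^esub> perm_elem n (transpose (Suc k) (Suc (Suc k)))"
      unfolding affine_shift_pow_perm_elem[OF k] using B k by (simp add: L.m_assoc)
    finally show ?thesis using n by (simp add: perm_elem_mult)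
  qed
  show ?thesis
  proof (unfold_locales)
    show "?B \<otimes>\<^bsub>?L\<^esub> ?B = \<one>\<^bsub>?L\<^esub>"
      using n by (simp add: perm_elem_mult one_perm_elem)
    have "transpose 1 2 \<circ> transpose 2 3 permutes {1..n}"
      using n by (intro permutes_compose) auto
    moreover have "transpose 1 2 \<circ> transpose 2 3 \<circ> (transpose 1 2 \<circ> transpose 2 3) \<circ> (transpose 1 2 \<circ> transpose 2 3) = (id :: nat \<Rightarrow> nat)"
      by (rule transpose_braid_id) auto
    ultimately show "(?B \<otimes>\<^bsub>?L\<^esub> ?A \<otimes>\<^bsub>?L\<^esub> ?B \<otimes>\<^bsub>?L\<^esub> inv\<^bsub>?L\<^esub> ?A) [^]\<^bsub>?L\<^esub> (3::nat)
        = \<one>\<^bsub>?L\<^esub>"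
      using conj[of 1] n
      by (simp add: L.nat_pow_3 perm_elem_mult one_perm_elem permutes_compose Suc_1 flip: numeral_3_eq_3)
  next
    fix k assume k: "2 \<le> k" "k \<le> n - 2"
    have "transpose 1 2 \<circ> transpose (Suc k) (Suc (Suc k)) permutes {1..n}"
      using n k by (intro permutes_compose) auto
    moreover have "transpose 1 2 \<circ> transpose (Suc k) (Suc (Suc k)) \<circ> (transpose 1 2 \<circ> transpose (Suc k) (Suc (Suc k))) = id"
      using k by (intro transpose_far_id) auto
    ultimately show "(?B \<otimes>\<^bsub>?L\<^esub> ?A [^]\<^bsub>?L\<^esub> k \<otimes>\<^bsub>?L\<^esub> ?B \<otimes>\<^bsub>?L\<^esub> inv\<^bsub>?L\<^esub> (?A [^]\<^bsub>?L\<^esub> k)) [^]\<^bsub>?L\<^esub> (2::nat)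
        = \<one>\<^bsub>?L\<^esub>"
      using conj[of k] k n by (simp add: L.nat_pow_2 perm_elem_mult one_perm_elem)
  next
    \<comment> \<open>The exponent \<open>n\<close> is beyond the range of \<open>conj\<close>. It
      is split as 2 + \<open>m\<close>: the inner power turns \<open>?B\<close> into the last
      transposition, and the double shift turns that back into \<open>?B\<close>.\<close>
    define m where "m = n - 2"
    have m: "n = Suc (Suc m)" using n by (simp add: m_def)
    let ?T = "perm_elem n (transpose (n - 1) n)"
    have T: "?T \<in> carrier ?L" using n by simp
    have "?A [^]\<^bsub>?L\<^esub> n = ?A [^]\<^bsub>?L\<^esub> Suc (Suc m)"
      by (rule arg_cong[OF m])
    also have "\<dots> = ?A \<otimes>\<^bsub>?L\<^esub> (?A \<otimes>\<^bsub>?L\<^esub> ?A [^]\<^bsub>?L\<^esub> m)"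
      by (simp only: L.nat_pow_Suc2 affine_shift_closed)
    finally have pow: "?A [^]\<^bsub>?L\<^esub> n
        = ?A \<otimes>\<^bsub>?L\<^esub> (?A \<otimes>\<^bsub>?L\<^esub> ?A [^]\<^bsub>?L\<^esub> m)" .
    have "?A [^]\<^bsub>?L\<^esub> n \<otimes>\<^bsub>?L\<^esub> ?B
        = ?A \<otimes>\<^bsub>?L\<^esub> (?A \<otimes>\<^bsub>?L\<^esub> (?A [^]\<^bsub>?L\<^esub> m \<otimes>\<^bsub>?L\<^esub> ?B))"
      unfolding pow using B by (simp add: L.m_assoc)
    also have "?A [^]\<^bsub>?L\<^esub> m \<otimes>\<^bsub>?L\<^esub> ?B
        = ?T \<otimes>\<^bsub>?L\<^esub> ?A [^]\<^bsub>?L\<^esub> m"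
    proof -
      have "m + 2 \<le> n" "Suc m = n - 1" "Suc (Suc m) = n" using m by auto
      then show ?thesis using affine_shift_pow_perm_elem[of m] by simp
    qed
    also have "?A \<otimes>\<^bsub>?L\<^esub> (?A \<otimes>\<^bsub>?L\<^esub> (?T \<otimes>\<^bsub>?L\<^esub> ?A [^]\<^bsub>?L\<^esub> m))
        = ?A \<otimes>\<^bsub>?L\<^esub> (?A \<otimes>\<^bsub>?L\<^esub> ?T) \<otimes>\<^bsub>?L\<^esub> ?A [^]\<^bsub>?L\<^esub> m"
      using T by (simp add: L.m_assoc)
    also have "\<dots> = ?B \<otimes>\<^bsub>?L\<^esub> ?A [^]\<^bsub>?L\<^esub> n"
      unfolding affine_shift_twice pow using B by (simp add: L.m_assoc)
    finally have comm: "?A [^]\<^bsub>?L\<^esub> n \<otimes>\<^bsub>?L\<^esub> ?B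
        = ?B \<otimes>\<^bsub>?L\<^esub> ?A [^]\<^bsub>?L\<^esub> n" .
    have "?B \<otimes>\<^bsub>?L\<^esub> ?A [^]\<^bsub>?L\<^esub> n \<otimes>\<^bsub>?L\<^esub> ?B \<otimes>\<^bsub>?L\<^esub> inv\<^bsub>?L\<^esub> (?A [^]\<^bsub>?L\<^esub> n)
        = ?B \<otimes>\<^bsub>?L\<^esub> (?A [^]\<^bsub>?L\<^esub> n \<otimes>\<^bsub>?L\<^esub> ?B) \<otimes>\<^bsub>?L\<^esub> inv\<^bsub>?L\<^esub> (?A [^]\<^bsub>?L\<^esub> n)"
      using B by (simp add: L.m_assoc)
    also have "\<dots> = ?B \<otimes>\<^bsub>?L\<^esub> ?B" unfolding comm using B by (simp add: L.m_assoc)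
    also have "\<dots> = \<one>\<^bsub>?L\<^esub>" using n by (simp add: perm_elem_mult one_perm_elem)
    finally show "?B \<otimes>\<^bsub>?L\<^esub> ?A [^]\<^bsub>?L\<^esub> n \<otimes>\<^bsub>?L\<^esub> ?B \<otimes>\<^bsub>?L\<^esub> inv\<^bsub>?L\<^esub> (?A [^]\<^bsub>?L\<^esub> n) = \<one>\<^bsub>?L\<^esub>" .
  qed (use n in auto)
qed

end

section \<open>The isomorphism\<close>

text \<open>This is the permutation of the word \<open>desc j k\<close>, with points counted from 1:
  a cycle of length \<open>k + 1\<close> on j+1, ..., j+k+1.\<close>

definition desc_perm :: "nat \<Rightarrow> nat \<Rightarrow> nat \<Rightarrow> nat" where
  "desc_perm j k i = (if i = Suc j then Suc (j + k)
     else if Suc j < i \<and> i \<le> Suc (j + k) then i - 1 else i)"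

lemma desc_perm_0: "desc_perm j 0 = id"
  by (auto simp: fun_eq_iff desc_perm_def)

lemma desc_perm_Suc:
  "transpose (Suc (j + k)) (Suc (Suc (j + k))) \<circ> desc_perm j k = desc_perm j (Suc k)"
proof
  fix i
  consider "i = Suc j" | "Suc j < i" "i \<le> Suc (j + k)" | "i = Suc (Suc (j + k))"
    | "i < Suc j" | "Suc (Suc (j + k)) < i"
    by linarith
  then show "(transpose (Suc (j + k)) (Suc (Suc (j + k))) \<circ> desc_perm j k) i = desc_perm j (Suc k) i"
    by cases (auto simp: desc_perm_def transpose_def)
qed

lemma desc_perm_permutes: "desc_perm j k permutes {1..Suc (j + k)}"
proof (induction k)
  case 0
  show ?case unfolding desc_perm_0 by (rule permutes_id)
next
  case (Suc k)
  have "transpose (Suc (j + k)) (Suc (Suc (j + k))) permutes {1..Suc (j + Suc k)}"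
    by (rule permutes_swap_id) auto
  moreover have "desc_perm j k permutes {1..Suc (j + Suc k)}"
    by (rule permutes_subset[OF Suc]) auto
  ultimately show ?case
    unfolding desc_perm_Suc[symmetric] by (rule permutes_compose[rotated])
qed

text \<open>The coset of \<open>\<sigma>\<close> is determined by the preimage j+1 of the last point
  k+2. The cycle \<open>desc_perm j (Suc k - j)\<close> has the same preimage, so removing it leaves
  a permutation that fixes k+2.\<close>

lemma permutes_last_factor:
  assumes "\<sigma> permutes {1..Suc (Suc k)}"
  obtains \<tau> j where "j \<le> Suc k" "\<tau> permutes {1..Suc k}" "\<sigma> = \<tau> \<circ> desc_perm j (Suc k - j)"
proof -
  have "inv' \<sigma> (Suc (Suc k)) \<in> {1..Suc (Suc k)}"
    using permutes_in_image[OF permutes_inv[OF assms]] by simp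
  then obtain j where j: "inv' \<sigma> (Suc (Suc k)) = Suc j" "j \<le> Suc k"
    by (cases "inv' \<sigma> (Suc (Suc k))") auto
  let ?\<delta> = "desc_perm j (Suc k - j)"
  have \<delta>: "?\<delta> permutes {1..Suc (Suc k)}"
    using desc_perm_permutes[of j "Suc k - j"] j(2) by simp
  have \<delta>j: "?\<delta> (Suc j) = Suc (Suc k)" using j(2) by (simp add: desc_perm_def)
  have "\<sigma> \<circ> inv' ?\<delta> permutes {1..Suc k}"
  proof (rule permutes_superset)
    show "\<sigma> \<circ> inv' ?\<delta> permutes {1..Suc (Suc k)}"
      by (rule permutes_compose[OF permutes_inv[OF \<delta>] assms])
    fix x assume "x \<in> {1..Suc (Suc k)} - {1..Suc k}"
    then have x: "x = Suc (Suc k)" by auto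
    have "inv' ?\<delta> x = Suc j" using \<delta>j permutes_inverses(2)[OF \<delta>, of "Suc j"] by (simp add: x)
    then show "(\<sigma> \<circ> inv' ?\<delta>) x = x" using permutes_inverses(1)[OF assms, of x] by (simp add: x j)
  qed
  moreover have "\<sigma> = \<sigma> \<circ> inv' ?\<delta> \<circ> ?\<delta>"
    using permutes_inv_o(2)[OF \<delta>] by (simp add: o_assoc[symmetric])
  ultimately show ?thesis using that j(2) by blast
qed

section \<open>Evaluation of the words in the semidirect product\<close>

context
  fixes n :: nat
  assumes n: "n \<ge> 4"
begin

interpretation L: extended_affine "lattice_perm_group n" n "affine_shift n" "perm_elem n (transpose 1 2)"
  by (rule extended_affine_lattice_perm_group[OF n])

lemma perm_elem_closed_le:
  assumes "\<sigma> permutes {1..k}" "k \<le> n"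
  shows "perm_elem n \<sigma> \<in> carrier (lattice_perm_group n)" "\<sigma> permutes {1..n}"
proof -
  show "\<sigma> permutes {1..n}" by (rule permutes_subset[OF assms(1)]) (use assms(2) in auto)
  then show "perm_elem n \<sigma> \<in> carrier (lattice_perm_group n)" by (rule perm_elem_closed[OF n])
qed

lemma lattice_s:
  assumes "i + 2 \<le> n"
  shows "L.s i = perm_elem n (transpose (Suc i) (Suc (Suc i)))"
proof -
  have "transpose (Suc i) (Suc (Suc i)) permutes {1..n}"
    by (rule permutes_swap_id) (use assms in auto)
  then have "perm_elem n (transpose (Suc i) (Suc (Suc i))) \<in> carrier (lattice_perm_group n)"
    by (rule perm_elem_closed[OF n])
  then show ?thesis
    unfolding L.s_def affine_shift_pow_perm_elem[OF n assms] by (simp add: L.m_assoc)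
qed

lemma lattice_desc:
  assumes "j + k < n"
  shows "L.desc j k = perm_elem n (desc_perm j k)"
  using assms
proof (induction k)
  case 0
  show ?case by (simp only: L.desc.simps desc_perm_0 one_perm_elem[OF n])
next
  case (Suc k)
  have "transpose (Suc (j + k)) (Suc (Suc (j + k))) permutes {1..n}"
    by (rule permutes_swap_id) (use Suc.prems in auto)
  then show ?case
    using Suc by (simp add: lattice_s perm_elem_mult[OF n] desc_perm_Suc)
qed

text \<open>The cycle in \<open>affine_shift\<close> cancels against
  \<open>desc_perm 0 (n - 1)\<close> and leaves a unit vector, which the transpositions move along.
  Indices of \<open>t\<close> start at 0, coordinates at 1.\<close>

lemma lattice_t:
  assumes "i < n"
  shows "L.t i = (unit_vec n (Suc i), id)"
  using assms
proof (induction i)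
  case 0
  have "cycle_perm n \<circ> desc_perm 0 (n - 1) = id"
    using n by (auto simp: fun_eq_iff cycle_perm_def desc_perm_def)
  moreover have "L.t 0 = affine_shift n \<otimes>\<^bsub>lattice_perm_group n\<^esub> perm_elem n (desc_perm 0 (n - 1))"
    using n by (simp add: lattice_desc)
  moreover have "\<dots> = (unit_vec n 1, cycle_perm n \<circ> desc_perm 0 (n - 1))"
    unfolding affine_shift_def
    by (rule mult_perm_elem[OF n]) (simp_all add: unit_vec_def cycle_perm_permutes[OF n])
  ultimately show ?case by (simp add: One_nat_def id_def)
next
  case (Suc i)
  let ?\<tau> = "transpose (Suc i) (Suc (Suc i))"
  have \<tau>: "?\<tau> permutes {1..n}"
    by (rule permutes_swap_id) (use Suc.prems in auto)
  have "perm_elem n ?\<tau> \<otimes>\<^bsub>lattice_perm_group n\<^esub> (unit_vec n (Suc i), id)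
      = (unit_vec n (Suc (Suc i)), ?\<tau>)"
    using Suc.prems by (auto simp: perm_elem_mult_pair[OF n] unit_vec_def transpose_def intro!: restrict_ext)
  moreover have "(unit_vec n (Suc (Suc i)), ?\<tau>) \<otimes>\<^bsub>lattice_perm_group n\<^esub> perm_elem n ?\<tau>
      = (unit_vec n (Suc (Suc i)), id)"
    using \<tau> by (subst mult_perm_elem[OF n]) (auto simp: unit_vec_def)
  ultimately show ?case
    using Suc by (simp add: lattice_s id_def)
qed

lemma lattice_t_pow:
  fixes z :: int
  assumes "i < n"
  shows "L.t i [^]\<^bsub>lattice_perm_group n\<^esub> z = (\<lambda>j\<in>{1..n}. if j = Suc i then z else 0, id)"
proof -
  \<comment> \<open>All integer powers, negative ones included, are obtained from a homomorphism out
    of the integers evaluated at 1.\<close>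
  let ?h = "\<lambda>z. (\<lambda>j\<in>{1..n}. if j = Suc i then z else (0 :: int), id :: nat \<Rightarrow> nat)"
  have "?h \<in> hom integer_group (lattice_perm_group n)"
    by (rule homI)
      (auto simp: carrier_lattice_perm_group mult_lattice_perm_group permutes_id intro!: restrict_ext)
  then interpret h: group_hom integer_group "lattice_perm_group n" ?h
    by (simp add: group_hom_def group_hom_axioms_def group_lattice_perm_group)
  have one_pow: "(1 :: int) [^]\<^bsub>integer_group\<^esub> z = z" by simp
  have "?h (1 [^]\<^bsub>integer_group\<^esub> z) = ?h 1 [^]\<^bsub>lattice_perm_group n\<^esub> z"
    by (rule h.hom_int_pow) simp
  then show ?thesis
    unfolding one_pow lattice_t[OF assms] unit_vec_def by simp
qed

lemma lattice_t_prod: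
  assumes "k \<le> n"
  shows "L.t_prod m k = (\<lambda>i\<in>{1..n}. if i \<le> k then m (i - 1) else 0, id)"
  using assms
proof (induction k)
  case 0
  show ?case by (auto simp: one_lattice_perm_group intro!: restrict_ext)
next
  case (Suc k)
  then show ?case
    by (auto simp: lattice_t_pow mult_lattice_perm_group intro!: restrict_ext)
qed

lemma lattice_perm_words:
  assumes "k < n"
  shows "L.perm_words k = perm_elem n ` {\<sigma>. \<sigma> permutes {1..Suc k}}"
  using assms
proof (induction k)
  case 0
  have "{\<sigma>. \<sigma> permutes {1..Suc 0}} = {id}"
    using permutes_sing[of _ "Suc 0"] by (simp add: One_nat_def)
  then show ?case by (simp add: one_perm_elem[OF n] id_def)
next
  case (Suc k)
  have mult: "perm_elem n \<tau> \<otimes>\<^bsub>lattice_perm_group n\<^esub> L.desc j (Suc k - j)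
      = perm_elem n (\<tau> \<circ> desc_perm j (Suc k - j))"
    if "j \<le> Suc k" "\<tau> permutes {1..Suc k}" for \<tau> j
    using that Suc.prems perm_elem_closed_le(2)[of \<tau> "Suc k"]
    by (simp add: lattice_desc perm_elem_mult[OF n])
  have perm: "\<tau> \<circ> desc_perm j (Suc k - j) permutes {1..Suc (Suc k)}"
    if "j \<le> Suc k" "\<tau> permutes {1..Suc k}" for \<tau> j
  proof (rule permutes_compose)
    show "desc_perm j (Suc k - j) permutes {1..Suc (Suc k)}"
      using desc_perm_permutes[of j "Suc k - j"] that(1) by simp
    show "\<tau> permutes {1..Suc (Suc k)}" by (rule permutes_subset[OF that(2)]) auto
  qed
  have IH: "L.perm_words k = perm_elem n ` {\<sigma>. \<sigma> permutes {1..Suc k}}"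
    using Suc by simp
  show ?case
  proof (intro equalityI subsetI)
    fix w assume "w \<in> L.perm_words (Suc k)"
    then obtain \<tau> j where "w = perm_elem n \<tau> \<otimes>\<^bsub>lattice_perm_group n\<^esub> L.desc j (Suc k - j)"
      "\<tau> permutes {1..Suc k}" "j \<le> Suc k"
      unfolding L.perm_words.simps IH by blast
    then show "w \<in> perm_elem n ` {\<sigma>. \<sigma> permutes {1..Suc (Suc k)}}"
      using mult perm by auto
  next
    fix w assume "w \<in> perm_elem n ` {\<sigma>. \<sigma> permutes {1..Suc (Suc k)}}"
    then obtain \<sigma> where w: "w = perm_elem n \<sigma>" and "\<sigma> permutes {1..Suc (Suc k)}" by auto
    then obtain \<tau> j where \<sigma>: "j \<le> Suc k" "\<tau> permutes {1..Suc k}" "\<sigma> = \<tau> \<circ> desc_perm j (Suc k - j)"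
      using permutes_last_factor by blast
    have "w = perm_elem n \<tau> \<otimes>\<^bsub>lattice_perm_group n\<^esub> L.desc j (Suc k - j)"
      unfolding w \<sigma>(3) by (rule mult[OF \<sigma>(1,2), symmetric])
    moreover have "perm_elem n \<tau> \<in> L.perm_words k" using \<sigma>(2) by (simp add: IH)
    ultimately show "w \<in> L.perm_words (Suc k)"
      unfolding L.perm_words.simps using \<sigma>(1) by blast
  qed
qed

lemma perm_elem_eq_one_iff: "perm_elem n \<sigma> = \<one>\<^bsub>lattice_perm_group n\<^esub> \<longleftrightarrow> \<sigma> = id"
  by (simp add: perm_elem_def one_lattice_perm_group)

text \<open>Surjectivity realises each pair by a normal form. For a kernel element in normal form,
  the permutation part of the image forces \<open>w\<close> to be trivial, and then the translation
  part forces all exponents to vanish.\<close>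

lemma lattice_perm_group_iso:
  assumes G: "generated_extended_affine G n a b"
    and hom: "\<phi> \<in> hom G (lattice_perm_group n)"
    and \<phi>: "\<phi> a = affine_shift n" "\<phi> b = perm_elem n (transpose 1 2)"
  shows "\<phi> \<in> iso G (lattice_perm_group n)"
proof -
  interpret G: generated_extended_affine G n a b by (rule G)
  interpret extended_affine_hom G "lattice_perm_group n" n a b "affine_shift n"
    "perm_elem n (transpose 1 2)" \<phi>
    by unfold_locales (use hom \<phi> in auto)
  \<comment> \<open>The image of the prefix \<open>v\<close> fixes k+2, while the cycle of the last
    factor sends j+1 to k+2. A trivial composite forces j = k+1, so that factor is the empty word
    and the induction continues with \<open>v\<close>.\<close>
  have perm_words_trivial: "w = \<one>\<^bsub>G\<^esub>"
    if "w \<in> G.perm_words k" "k < n" "\<phi> w = \<one>\<^bsub>lattice_perm_group n\<^esub>" for w k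
    using that
  proof (induction k)
    case (Suc k)
    then obtain v j where w: "w = v \<otimes>\<^bsub>G\<^esub> G.desc j (Suc k - j)" and v: "v \<in> G.perm_words k"
      and j: "j \<le> Suc k" by auto
    have [simp]: "v \<in> carrier G" using v G.perm_words_closed by blast
    have "\<phi> v \<in> L.perm_words k" using v \<phi>_perm_words by blast
    then obtain \<tau> where \<phi>v: "\<phi> v = perm_elem n \<tau>" and \<tau>: "\<tau> permutes {1..Suc k}"
      using Suc.prems by (auto simp: lattice_perm_words)
    have "\<phi> w = perm_elem n (\<tau> \<circ> desc_perm j (Suc k - j))"
      using Suc.prems j perm_elem_closed_le(2)[OF \<tau>]
      by (simp add: w \<phi>_desc \<phi>v lattice_desc perm_elem_mult[OF n])
    then have "\<tau> \<circ> desc_perm j (Suc k - j) = id"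
      using Suc.prems(3) perm_elem_eq_one_iff by metis
    then have "\<tau> (desc_perm j (Suc k - j) (Suc j)) = Suc j" by (metis comp_apply id_apply)
    then have "\<tau> (Suc (Suc k)) = Suc j" using j by (simp add: desc_perm_def)
    moreover have "\<tau> (Suc (Suc k)) = Suc (Suc k)" using \<tau> by (rule permutes_not_in) auto
    ultimately have "w = v" by (simp add: w)
    then show ?case using Suc v by simp
  qed simp
  have "\<phi> ` carrier G = carrier (lattice_perm_group n)"
  proof (intro equalityI subsetI)
    fix p assume p: "p \<in> carrier (lattice_perm_group n)"
    obtain x \<sigma> where p': "p = (x, \<sigma>)" by (cases p)
    have x: "x \<in> {1..n} \<rightarrow>\<^sub>E UNIV" and \<sigma>: "\<sigma> permutes {1..n}"
      using p by (auto simp: p' carrier_lattice_perm_group)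
    have "perm_elem n \<sigma> \<in> L.perm_words (n - 1)"
      using n \<sigma> by (subst lattice_perm_words) auto
    then obtain w where w: "w \<in> G.perm_words (n - 1)" "\<phi> w = perm_elem n \<sigma>"
      unfolding \<phi>_perm_words[symmetric] by auto
    then have [simp]: "w \<in> carrier G" using G.perm_words_closed by blast
    \<comment> \<open>The permutation stands to the left and will move the coordinates, so the
      exponents are read off through \<open>\<sigma>\<close>; \<open>Suc\<close> passes from indices
      starting at 0 to coordinates starting at 1.\<close>
    define m where "m = (\<lambda>i. x (\<sigma> (Suc i)))"
    have "L.t_prod m n = (\<lambda>i\<in>{1..n}. x (\<sigma> i), id)"
      by (auto simp: lattice_t_prod m_def intro!: restrict_ext)
    then have "\<phi> (w \<otimes>\<^bsub>G\<^esub> G.t_prod m n)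
        = perm_elem n \<sigma> \<otimes>\<^bsub>lattice_perm_group n\<^esub> (\<lambda>i\<in>{1..n}. x (\<sigma> i), id)"
      by (simp add: w \<phi>_t_prod)
    also have "\<dots> = (\<lambda>i\<in>{1..n}. (\<lambda>i\<in>{1..n}. x (\<sigma> i)) (inv' \<sigma> i), \<sigma>)"
      by (subst perm_elem_mult_pair[OF n]) auto
    also have "(\<lambda>i\<in>{1..n}. (\<lambda>i\<in>{1..n}. x (\<sigma> i)) (inv' \<sigma> i)) = x"
    proof
      fix i
      show "(\<lambda>i\<in>{1..n}. (\<lambda>i\<in>{1..n}. x (\<sigma> i)) (inv' \<sigma> i)) i = x i"
        using x permutes_inverses(1)[OF \<sigma>] permutes_in_image[OF permutes_inv[OF \<sigma>], of i]
        by (auto simp: PiE_def extensional_def)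
    qed
    finally have "\<phi> (w \<otimes>\<^bsub>G\<^esub> G.t_prod m n) = p" by (simp only: p')
    then show "p \<in> \<phi> ` carrier G" by (rule image_eqI[OF sym]) simp
  qed auto
  moreover have "x = \<one>\<^bsub>G\<^esub>" if x: "x \<in> carrier G" and one: "\<phi> x = \<one>\<^bsub>lattice_perm_group n\<^esub>" for x
  proof -
    obtain w m where w: "w \<in> G.perm_words (n - 1)" and xw: "x = w \<otimes>\<^bsub>G\<^esub> G.t_prod m n"
      using G.normal_form[OF x] by blast
    have [simp]: "w \<in> carrier G" using w G.perm_words_closed by blast
    have "\<phi> w \<in> L.perm_words (n - 1)" using w \<phi>_perm_words by blast
    then obtain \<sigma> where \<phi>w: "\<phi> w = perm_elem n \<sigma>"
      using n by (auto simp: lattice_perm_words)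
    let ?y = "\<lambda>i\<in>{1..n}. m (i - 1)"
    have tp: "L.t_prod m n = (?y, id)"
      by (auto simp: lattice_t_prod intro!: restrict_ext)
    have "\<phi> x = (\<lambda>i\<in>{1..n}. ?y (inv' \<sigma> i), \<sigma>)"
      unfolding xw using perm_elem_mult_pair[OF n, of ?y \<sigma> id] by (simp add: \<phi>w \<phi>_t_prod tp)
    then have "\<sigma> = id" using one by (simp add: one_lattice_perm_group)
    then have "\<phi> w = \<one>\<^bsub>lattice_perm_group n\<^esub>" using \<phi>w perm_elem_eq_one_iff by simp
    then have "w = \<one>\<^bsub>G\<^esub>" using perm_words_trivial[OF w] n by simp
    then have xt: "x = G.t_prod m n" by (simp add: xw)
    then have "(?y, id) = (\<lambda>i\<in>{1..n}. 0, id :: nat \<Rightarrow> nat)"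
      using one by (simp add: \<phi>_t_prod tp one_lattice_perm_group)
    then have y: "?y i = (\<lambda>i\<in>{1..n}. 0) i" for i by (metis prod.inject)
    have "m i = 0" if "i < n" for i using y[of "Suc i"] that by simp
    then show ?thesis unfolding xt by (rule G.t_prod_0)
  qed
  ultimately show ?thesis
    using hom G.is_group group_lattice_perm_group
    by (subst iso_kernel_image) (auto simp: kernel_def)
qed

end

theorem theorem1:
  fixes n :: nat
  assumes "n \<ge> 4"
  shows "lattice_perm_group n \<cong> presented_group (relators n)"
proof -
  let ?P = "presented_group (relators n)"
  let ?a = "free_gen Gen_a" and ?b = "free_gen Gen_b"
  have R: "relators n \<subseteq> carrier free_group"
    by (auto simp: relators_def Let_def)
  interpret P: group ?P by (rule group_presented_group[OF R])
  interpret \<pi>: group_hom free_group ?P "presented_class (relators n)"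
    using presented_class_hom[OF R]
    by (simp add: group_hom_def group_hom_axioms_def group_free_group P.is_group)
  define a where "a = presented_class (relators n) ?a"
  define b where "b = presented_class (relators n) ?b"
  have ab [simp]: "a \<in> carrier ?P" "b \<in> carrier ?P" by (simp_all add: a_def b_def)
  note rel = presented_class_relator[OF R]
  interpret P: generated_extended_affine ?P n a b
  proof unfold_locales
    have "presented_class (relators n) (?b [^]\<^bsub>free_group\<^esub> (2::nat)) = \<one>\<^bsub>?P\<^esub>"
      by (rule rel) (simp add: relators_def Let_def)
    then show "b \<otimes>\<^bsub>?P\<^esub> b
        = \<one>\<^bsub>?P\<^esub>" by (simp add: b_def \<pi>.hom_nat_pow P.nat_pow_2)
    have "presented_class (relators n) ((?b \<otimes>\<^bsub>free_group\<^esub> ?a \<otimes>\<^bsub>free_group\<^esub> ?b \<otimes>\<^bsub>free_group\<^esub> inv\<^bsub>free_group\<^esub> ?a) [^]\<^bsub>free_group\<^esub> (3::nat))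
        = \<one>\<^bsub>?P\<^esub>"
      by (rule rel) (simp add: relators_def Let_def)
    then show "(b \<otimes>\<^bsub>?P\<^esub> a \<otimes>\<^bsub>?P\<^esub> b \<otimes>\<^bsub>?P\<^esub> inv\<^bsub>?P\<^esub> a) [^]\<^bsub>?P\<^esub> (3::nat)
        = \<one>\<^bsub>?P\<^esub>"
      by (simp add: a_def b_def \<pi>.hom_nat_pow)
    have "presented_class (relators n) (?b \<otimes>\<^bsub>free_group\<^esub> ?a [^]\<^bsub>free_group\<^esub> n \<otimes>\<^bsub>free_group\<^esub> ?b \<otimes>\<^bsub>free_group\<^esub> ?a [^]\<^bsub>free_group\<^esub> (- int n))
        = \<one>\<^bsub>?P\<^esub>"
      by (rule rel) (simp add: relators_def Let_def)
    then show "b \<otimes>\<^bsub>?P\<^esub> a [^]\<^bsub>?P\<^esub> n \<otimes>\<^bsub>?P\<^esub> b \<otimes>\<^bsub>?P\<^esub> inv\<^bsub>?P\<^esub> (a [^]\<^bsub>?P\<^esub> n)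
        = \<one>\<^bsub>?P\<^esub>"
      by (simp add: a_def b_def \<pi>.hom_nat_pow free_group.int_pow_neg_int)
  next
    fix k :: nat assume k: "2 \<le> k" "k \<le> n - 2"
    have "presented_class (relators n) ((?b \<otimes>\<^bsub>free_group\<^esub> ?a [^]\<^bsub>free_group\<^esub> k \<otimes>\<^bsub>free_group\<^esub> ?b \<otimes>\<^bsub>free_group\<^esub> ?a [^]\<^bsub>free_group\<^esub> (- int k)) [^]\<^bsub>free_group\<^esub> (2::nat))
        = \<one>\<^bsub>?P\<^esub>"
      by (rule rel) (use k in \<open>auto simp: relators_def Let_def\<close>)
    then show "(b \<otimes>\<^bsub>?P\<^esub> a [^]\<^bsub>?P\<^esub> k \<otimes>\<^bsub>?P\<^esub> b \<otimes>\<^bsub>?P\<^esub> inv\<^bsub>?P\<^esub> (a [^]\<^bsub>?P\<^esub> k)) [^]\<^bsub>?P\<^esub> (2::nat)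
        = \<one>\<^bsub>?P\<^esub>"
      by (simp add: a_def b_def \<pi>.hom_nat_pow free_group.int_pow_neg_int)
  next
    fix H assume H: "subgroup H ?P" "a \<in> H" "b \<in> H"
    have "presented_class (relators n) (free_gen x) \<in> H" for x
      using H by (cases x) (auto simp: a_def b_def)
    then show "H = carrier ?P" by (rule presented_group_generated[OF R H(1)])
  qed (use assms in auto)
  interpret L: extended_affine "lattice_perm_group n" n "affine_shift n" "perm_elem n (transpose 1 2)"
    by (rule extended_affine_lattice_perm_group[OF assms])
  define f where "f = case_gen (affine_shift n) (perm_elem n (transpose 1 2))"
  have "f x \<in> carrier (lattice_perm_group n)" for x
    by (cases x) (auto simp: f_def)
  then obtain h where h_hom: "h \<in> hom free_group (lattice_perm_group n)"
    and "\<And>x. h (free_gen x) = f x"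
    using L.free_group_lift[of f] by blast
  then have h: "h ?a = affine_shift n" "h ?b = perm_elem n (transpose 1 2)"
    by (simp_all add: f_def)
  interpret h: group_hom free_group "lattice_perm_group n" h
    using h_hom by (simp add: group_hom_def group_hom_axioms_def group_free_group group_lattice_perm_group)
  \<comment> \<open>The relators contain negative integer powers, whereas the axioms of
    \<open>extended_affine\<close> use inverses of natural powers.\<close>
  have pow_neg: "?a [^]\<^bsub>free_group\<^esub> (- int k)
      = inv\<^bsub>free_group\<^esub> (?a [^]\<^bsub>free_group\<^esub> k)" for k
    by (simp add: free_group.int_pow_neg_int)
  have "h r = \<one>\<^bsub>lattice_perm_group n\<^esub>" if "r \<in> relators n" for r
    using that L.braid L.far L.period
    unfolding relators_def Let_def pow_neg
    by (auto simp only: Un_iff insert_iff empty_iff mem_Collect_eq h.hom_nat_pow h.hom_mult h.hom_inv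
        h free_group.m_closed free_group.inv_closed free_group.nat_pow_closed free_gen_closed
        L.nat_pow_2 L.b_sq L.b_closed)
  then obtain \<phi> where \<phi>: "\<phi> \<in> hom ?P (lattice_perm_group n)"
    "\<And>x. x \<in> carrier free_group \<Longrightarrow> \<phi> (presented_class (relators n) x) = h x"
    using presented_group_lift[OF R group_lattice_perm_group h_hom] by blast
  have "\<phi> \<in> iso ?P (lattice_perm_group n)"
    by (rule lattice_perm_group_iso[OF assms P.generated_extended_affine_axioms \<phi>(1)])
      (simp_all add: a_def b_def \<phi>(2) h)
  then have "?P \<cong> lattice_perm_group n" by (rule is_isoI)
  then show ?thesis by (rule P.iso_sym)
qed

end
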